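(* Suppose $f$ is $T$-periodic in $t$, and let $(\theta,\Phi)$ be the $T$-periodic nonautonomous random dynamical system on $\mathbb{R}$ generated by the SDE $\mathrm{d}x=f(t,x)\,\mathrm{d}t+\sigma\,\mathrm{d}W_t$. Assume: (i) there exists a unique stationary $T$-periodic measure $(\rho_\tau)_{\tau\in\mathbb{R}}$ for the associated non-homogeneous Markov semigroup; (ii) $(\theta,\Phi)$ has a global nonautonomous random attractor $A$ which is periodic, i.e. $A(\tau+T,\omega)=A(\tau,\omega)$ for all $\tau$ and almost all $\omega$. Then $A$ is a random periodic orbit: for all $\tau$ and almost all $\omega$, the fiber $A(\tau,\omega)$ is a single point.
   Context: Setting: $\sigma>0$, and $f:\mathbb{R}^2\to\mathbb{R}$ is continuously differentiable with $f(t+T,x)=f(t,x)$, such that the SDE has global solutions. The noise space is $\Omega=C_0(\mathbb{R},\mathbb{R})$ with Wiener measure and Wiener shift $\theta_t\omega=\omega(\cdot+t)-\omega(t)$. With $\mathcal X(t,\tau,\omega,x)$ the pathwise solution, the cocycle is $\Phi(t,\tau,\theta_\tau\omega,x)=\mathcal X(t+\tau,\tau,\omega,x)$; this cocycle is order preserving. Transition probabilities: $Q(t,\tau,x,B)=\mathbb{P}\{\mathcal X(\tau+t,\tau,\cdot,x)\in B\}$. A stationary $T$-periodic measure is a family $(\rho_\tau)$ of probability measures on $\mathbb{R}$ with $\rho_{\tau+t}(B)=\int Q(t,\tau,x,B)\,\mathrm{d}\rho_\tau(x)$ and $\rho_{\tau+T}=\rho_\tau$. A nonautonomous random set is a measurable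 $M\subset\mathbb{R}\times\Omega\times\mathbb{R}$ with fibers $M(\tau,\omega)$. It is invariant if $\Phi(t,\tau,\omega)M(\tau,\omega)=M(\tau+t,\theta_t\omega)$. A global nonautonomous random attractor is a compact invariant nonautonomous random set $A$ with $\operatorname{dist}\big(\Phi(t,\tau-t,\theta_{-t}\omega)C,A(\tau,\omega)\big)\to0$ as $t\to\infty$ for every bounded $C\subset\mathbb{R}$, all $\tau$ and almost all $\omega$. A random periodic orbit is an invariant nonautonomous random set with singleton fibers satisfying $\Phi(T,\tau,\omega)A(\tau,\omega)=A(\tau,\theta_T\omega)$. *)

theory Defs
  imports "HOL-Probability.Probability"
begin

definition Omega0 :: "(real \<Rightarrow> real) set" where
  "Omega0 = {\<omega>. continuous_on UNIV \<omega> \<and> \<omega> 0 = 0}"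

text \<open>Two-sided Wiener measure on C_0(R,R): a probability measure on Omega0 with the
  cylinder (evaluation) sigma-algebra, under which increments over consecutive times
  are independent and centred Gaussian with variance equal to the time increment.
  These finite-dimensional laws determine the measure uniquely.\<close>
definition wiener_measure :: "(real \<Rightarrow> real) measure \<Rightarrow> bool" where
  "wiener_measure W \<longleftrightarrow>
     prob_space W \<and> space W = Omega0 \<and>
     sets W = sets (restrict_space (Pi\<^sub>M (UNIV :: real set) (\<lambda>_. (borel :: real measure))) Omega0) \<and>
     (\<forall>ts :: real list. sorted_wrt (<) ts \<longrightarrow>
        prob_space.indep_vars W (\<lambda>_. (borel :: real measure))
          (\<lambda>i \<omega>. \<omega> (ts ! Suc i) - \<omega> (ts ! i)) {..<length ts - 1} \<and>
        (\<forall>i < length ts - 1.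
           distributed W lborel (\<lambda>\<omega>. \<omega> (ts ! Suc i) - \<omega> (ts ! i))
             (\<lambda>y. ennreal (normal_density 0 (sqrt (ts ! Suc i - ts ! i)) y))))"

definition wshift :: "real \<Rightarrow> (real \<Rightarrow> real) \<Rightarrow> (real \<Rightarrow> real)" where
  "wshift t \<omega> = (\<lambda>s. \<omega> (s + t) - \<omega> t)"

definition C1_2 :: "(real \<Rightarrow> real \<Rightarrow> real) \<Rightarrow> bool" where
  "C1_2 f \<longleftrightarrow> (\<exists>ft fx :: real \<times> real \<Rightarrow> real.
      continuous_on UNIV ft \<and> continuous_on UNIV fx \<and>
      (\<forall>p. ((\<lambda>q. f (fst q) (snd q)) has_derivative (\<lambda>h. ft p * fst h + fx p * snd h)) (at p)))"

definition pathwise_solution ::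
  "(real \<Rightarrow> real \<Rightarrow> real) \<Rightarrow> real \<Rightarrow>
   (real \<Rightarrow> real \<Rightarrow> (real \<Rightarrow> real) \<Rightarrow> real \<Rightarrow> real) \<Rightarrow> bool" where
  "pathwise_solution f \<sigma> X \<longleftrightarrow>
     (\<forall>\<omega>\<in>Omega0. \<forall>\<tau> x.
        continuous_on {\<tau>..} (\<lambda>s. X s \<tau> \<omega> x) \<and>
        (\<forall>s\<ge>\<tau>. X s \<tau> \<omega> x =
            x + integral {\<tau>..s} (\<lambda>r. f r (X r \<tau> \<omega> x)) + \<sigma> * (\<omega> s - \<omega> \<tau>)))"

text \<open>Cocycle: Phi(t,tau,theta_tau omega,x) = X(t+tau,tau,omega,x); equivalently
  Phi(t,tau,omega,x) = X(t+tau,tau,theta_{-tau} omega,x) since theta_tau theta_{-tau} = id on Omega0.\<close>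
definition cocycle ::
  "(real \<Rightarrow> real \<Rightarrow> (real \<Rightarrow> real) \<Rightarrow> real \<Rightarrow> real) \<Rightarrow>
   real \<Rightarrow> real \<Rightarrow> (real \<Rightarrow> real) \<Rightarrow> real \<Rightarrow> real" where
  "cocycle X t \<tau> \<omega> x = X (t + \<tau>) \<tau> (wshift (- \<tau>) \<omega>) x"

definition transition ::
  "(real \<Rightarrow> real) measure \<Rightarrow> (real \<Rightarrow> real \<Rightarrow> (real \<Rightarrow> real) \<Rightarrow> real \<Rightarrow> real) \<Rightarrow>
   real \<Rightarrow> real \<Rightarrow> real \<Rightarrow> real set \<Rightarrow> real" where
  "transition W X t \<tau> x B = measure W {\<omega> \<in> space W. X (\<tau> + t) \<tau> \<omega> x \<in> B}"

definition stationary_periodic_measure ::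
  "(real \<Rightarrow> real) measure \<Rightarrow> (real \<Rightarrow> real \<Rightarrow> (real \<Rightarrow> real) \<Rightarrow> real \<Rightarrow> real) \<Rightarrow> real \<Rightarrow>
   (real \<Rightarrow> real measure) \<Rightarrow> bool" where
  "stationary_periodic_measure W X T \<rho> \<longleftrightarrow>
     (\<forall>\<tau>. prob_space (\<rho> \<tau>) \<and> sets (\<rho> \<tau>) = sets (borel :: real measure)) \<and>
     (\<forall>\<tau> t B. t \<ge> 0 \<longrightarrow> B \<in> sets (borel :: real measure) \<longrightarrow>
        measure (\<rho> (\<tau> + t)) B = (\<integral>x. transition W X t \<tau> x B \<partial>(\<rho> \<tau>))) \<and>
     (\<forall>\<tau>. \<rho> (\<tau> + T) = \<rho> \<tau>)"

definition hsemidist :: "real set \<Rightarrow> real set \<Rightarrow> real" where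
  "hsemidist C A = (if C = {} then 0 else (SUP c\<in>C. infdist c A))"

definition nonaut_random_set :: "(real \<Rightarrow> real) measure \<Rightarrow> (real \<Rightarrow> (real \<Rightarrow> real) \<Rightarrow> real set) \<Rightarrow> bool" where
  "nonaut_random_set W A \<longleftrightarrow>
     {(\<tau>, \<omega>, x). \<omega> \<in> space W \<and> x \<in> A \<tau> \<omega>} \<in> sets (borel \<Otimes>\<^sub>M (W \<Otimes>\<^sub>M borel))"

definition invariant_set ::
  "(real \<Rightarrow> real) measure \<Rightarrow> (real \<Rightarrow> real \<Rightarrow> (real \<Rightarrow> real) \<Rightarrow> real \<Rightarrow> real) \<Rightarrow>
   (real \<Rightarrow> (real \<Rightarrow> real) \<Rightarrow> real set) \<Rightarrow> bool" where
  "invariant_set W Phi A \<longleftrightarrow>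
     nonaut_random_set W A \<and>
     (\<forall>t \<tau>. t \<ge> 0 \<longrightarrow> (AE \<omega> in W. Phi t \<tau> \<omega> ` A \<tau> \<omega> = A (\<tau> + t) (wshift t \<omega>)))"

definition global_attractor ::
  "(real \<Rightarrow> real) measure \<Rightarrow> (real \<Rightarrow> real \<Rightarrow> (real \<Rightarrow> real) \<Rightarrow> real \<Rightarrow> real) \<Rightarrow>
   (real \<Rightarrow> (real \<Rightarrow> real) \<Rightarrow> real set) \<Rightarrow> bool" where
  "global_attractor W Phi A \<longleftrightarrow>
     invariant_set W Phi A \<and>
     (\<forall>\<tau>. \<forall>\<omega>\<in>space W. compact (A \<tau> \<omega>) \<and> A \<tau> \<omega> \<noteq> {}) \<and>
     (\<forall>C \<tau>. bounded C \<longrightarrow>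
        (AE \<omega> in W. ((\<lambda>t. hsemidist (Phi t (\<tau> - t) (wshift (- t) \<omega>) ` C) (A \<tau> \<omega>))
                        \<longlongrightarrow> 0) at_top))"

definition random_periodic_orbit ::
  "(real \<Rightarrow> real) measure \<Rightarrow> (real \<Rightarrow> real \<Rightarrow> (real \<Rightarrow> real) \<Rightarrow> real \<Rightarrow> real) \<Rightarrow> real \<Rightarrow>
   (real \<Rightarrow> (real \<Rightarrow> real) \<Rightarrow> real set) \<Rightarrow> bool" where
  "random_periodic_orbit W Phi T A \<longleftrightarrow>
     invariant_set W Phi A \<and>
     (\<forall>\<tau>. AE \<omega> in W. \<exists>a. A \<tau> \<omega> = {a}) \<and>
     (\<forall>\<tau>. AE \<omega> in W. Phi T \<tau> \<omega> ` A \<tau> \<omega> = A \<tau> (wshift T \<omega>))"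

end

theory Submission
  imports Defs
begin

text \<open>
  The maximum and the minimum of the fibres of the attractor are carried along by the order-preserving cocycle.
  They are limits in probability of pullback solutions started at the constants \<open>n\<close> and \<open>-n\<close>, hence depend
  only on the past of the noise, which is independent of the noise driving the cocycle forward in time.
  Therefore their laws are stationary \<open>T\<close>-periodic measures, which coincide by uniqueness; as the minimum is
  below the maximum, equality of the laws forces them to agree almost surely.
  That the maximum and the minimum are random variables (up to null sets) is an instance of the measurable
  projection theorem.
\<close>

text \<open>The extremal points are approximated only in probability because attraction bounds a
  pullback solution from one side only. The solution started at \<open>n\<close> stays above the
  maximum if the maximum at the starting time is itself below \<open>n\<close>, and the fibres need
  not be bounded uniformly in the noise. Pulling back by multiples of \<open>T\<close> and using the
  periodicity of \<open>A\<close> turns this condition into an event whose probability does not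
  depend on the pullback time. Independence of past and future is not phrased with sigma-algebras:
  the past of one Wiener path followed by the future of an independent one is again a Wiener path.
  Being determined by the past then becomes an almost sure identity, which survives null sets and
  limits in probability. Order preservation, uniqueness of solutions and measurability in the noise
  are all drawn from one Euler scheme. Projections enter because the fibres are known only through
  the measurability of their joint graph, and the event that a fibre meets a half-line is a
  projection of it, measurable in the completion.\<close>

section \<open>Measurable projections\<close>

text \<open>Membership in a product-measurable set is expressed by the Suslin operation over the branches \<open>z\<close>,
  applied to sets with closed sections of which only finitely many are distinct; they are encoded as set-valued
  simple functions of \<open>\<omega>\<close>, so that hitting a fixed compact set is a measurable event.\<close>
definition closed_simple_scheme ::
  "'a measure \<Rightarrow> (nat \<Rightarrow> (nat \<Rightarrow> nat) \<Rightarrow> 'a \<Rightarrow> real set) \<Rightarrow> bool" where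
  "closed_simple_scheme N S \<longleftrightarrow>
     (\<forall>n z. simple_function N (S n z)) \<and> (\<forall>n z \<omega>. closed (S n z \<omega>)) \<and>
     (\<forall>n z z'. (\<forall>i<n. z i = z' i) \<longrightarrow> S n z = S n z')"

text \<open>The finite index sequences of a Suslin scheme are represented by infinite ones of which
  level \<open>n\<close> sees only the first \<open>n\<close> entries; every recoding of branches
  has to respect this.\<close>

lemma scheme_dep:
  "closed_simple_scheme N S \<Longrightarrow> (\<And>i. i < n \<Longrightarrow> z i = z' i) \<Longrightarrow> S n z = S n z'"
  unfolding closed_simple_scheme_def by blast

text \<open>Nothing is asked outside \<open>space N\<close>, so sets that agree over
  \<open>space N\<close> share the property.\<close>

definition suslin :: "'a measure \<Rightarrow> ('a \<times> real) set \<Rightarrow> bool" where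
  "suslin N M \<longleftrightarrow> (\<exists>S. closed_simple_scheme N S \<and>
     (\<forall>\<omega>\<in>space N. \<forall>x. (\<omega>, x) \<in> M \<longleftrightarrow> (\<exists>z. \<forall>n. x \<in> S n z \<omega>)))"

lemma suslin_closed_rectangle:
  assumes "F \<in> sets N" "closed C"
  shows "suslin N (F \<times> C)"
proof -
  define S :: "nat \<Rightarrow> (nat \<Rightarrow> nat) \<Rightarrow> 'a \<Rightarrow> real set" where "S = (\<lambda>n z \<omega>. if \<omega> \<in> F then C else {})"
  have "simple_function N (\<lambda>\<omega>. if \<omega> \<in> F then C else {})"
    using assms by (intro simple_function_If_set) auto
  then have "closed_simple_scheme N S"
    using assms by (auto simp: closed_simple_scheme_def S_def)
  then show ?thesis
    unfolding suslin_def by (intro exI[of _ S]) (auto simp: S_def)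
qed

text \<open>Coordinate 0 of the new branch selects the set, the remaining ones are a branch for it.
  Levels move up by one, and level 0, which may see no coordinate, is trivial.\<close>

lemma suslin_Union:
  assumes "\<And>i::nat. suslin N (M i)"
  shows "suslin N (\<Union>i. M i)"
proof -
  from assms obtain S where S: "\<And>i. closed_simple_scheme N (S i)"
    and M: "\<And>i \<omega> x. \<omega> \<in> space N \<Longrightarrow> (\<omega>, x) \<in> M i \<longleftrightarrow> (\<exists>z. \<forall>n. x \<in> S i n z \<omega>)"
    unfolding suslin_def by metis
  define R where "R n z = (case n of 0 \<Rightarrow> (\<lambda>\<omega>. UNIV) | Suc k \<Rightarrow> S (z 0) k (\<lambda>j. z (Suc j)))" for n z
  have "R n z = R n z'" if "\<forall>i<n. z i = z' i" for n z z'
  proof (cases n)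
    case (Suc k)
    then have "S (z 0) k (\<lambda>j. z (Suc j)) = S (z 0) k (\<lambda>j. z' (Suc j))"
      using that by (intro scheme_dep[OF S]) auto
    then show ?thesis using Suc that by (simp add: R_def)
  qed (simp add: R_def)
  moreover have "simple_function N (R n z)" "closed (R n z \<omega>)" for n z \<omega>
    using S unfolding closed_simple_scheme_def R_def by (auto split: nat.split)
  ultimately have R: "closed_simple_scheme N R"
    unfolding closed_simple_scheme_def by blast
  have "(\<exists>i. (\<omega>, x) \<in> M i) \<longleftrightarrow> (\<exists>z. \<forall>n. x \<in> R n z \<omega>)" if \<omega>: "\<omega> \<in> space N" for \<omega> x
  proof
    assume "\<exists>i. (\<omega>, x) \<in> M i"
    then obtain i z where z: "\<And>n. x \<in> S i n z \<omega>"
      using M[OF \<omega>] by blast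
    have "x \<in> R n (case_nat i z) \<omega>" for n
      using z by (simp add: R_def split: nat.split)
    then show "\<exists>z. \<forall>n. x \<in> R n z \<omega>" by blast
  next
    assume "\<exists>z. \<forall>n. x \<in> R n z \<omega>"
    then obtain z where "x \<in> R (Suc n) z \<omega>" for n by blast
    then have "(\<omega>, x) \<in> M (z 0)"
      unfolding M[OF \<omega>] by (intro exI[of _ "\<lambda>j. z (Suc j)"]) (auto simp: R_def)
    then show "\<exists>i. (\<omega>, x) \<in> M i" by blast
  qed
  with R show ?thesis unfolding suslin_def by auto
qed

text \<open>Ensures that the first \<open>j\<close> entries of the \<open>i\<close>-th interleaved
  branch sit at positions below \<open>prod_encode (i, j)\<close>, the level at which they are
  read.\<close>

lemma prod_encode_strict_mono_right: "l < j \<Longrightarrow> prod_encode (i, l) < prod_encode (i, j)"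
proof -
  assume "l < j"
  moreover have "triangle a < triangle b" if "a < b" for a b
    using that by (induction b) (auto simp: less_Suc_eq)
  ultimately show ?thesis by (simp add: prod_encode_def)
qed

text \<open>One branch interleaves a branch for each \<open>i\<close>; level
  \<open>prod_encode (i, j)\<close> tests level \<open>j\<close> of the \<open>i\<close>-th
  scheme.\<close>

lemma suslin_Inter:
  assumes "\<And>i::nat. suslin N (M i)"
  shows "suslin N (\<Inter>i. M i)"
proof -
  from assms obtain S where S: "\<And>i. closed_simple_scheme N (S i)"
    and M: "\<And>i \<omega> x. \<omega> \<in> space N \<Longrightarrow> (\<omega>, x) \<in> M i \<longleftrightarrow> (\<exists>z. \<forall>n. x \<in> S i n z \<omega>)"
    unfolding suslin_def by metis
  define R where "R n z = S (fst (prod_decode n)) (snd (prod_decode n))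
      (\<lambda>l. z (prod_encode (fst (prod_decode n), l)))" for n and z :: "nat \<Rightarrow> nat"
  have R_enc: "R (prod_encode (i, j)) z = S i j (\<lambda>l. z (prod_encode (i, l)))" for i j z
    by (simp add: R_def)
  have "R n z = R n z'" if z: "\<forall>i<n. z i = z' i" for n z z'
  proof -
    obtain i j where n: "n = prod_encode (i, j)" by (metis prod_decode_inverse surj_pair)
    have "\<forall>l<j. z (prod_encode (i, l)) = z' (prod_encode (i, l))"
      using z prod_encode_strict_mono_right unfolding n by blast
    then show ?thesis
      unfolding n R_enc by (intro scheme_dep[OF S]) auto
  qed
  moreover have "simple_function N (R n z)" "closed (R n z \<omega>)" for n z \<omega>
    using S unfolding closed_simple_scheme_def R_def by auto
  ultimately have R: "closed_simple_scheme N R"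
    unfolding closed_simple_scheme_def by blast
  have "(\<forall>i. (\<omega>, x) \<in> M i) \<longleftrightarrow> (\<exists>z. \<forall>n. x \<in> R n z \<omega>)" if \<omega>: "\<omega> \<in> space N" for \<omega> x
  proof
    assume "\<forall>i. (\<omega>, x) \<in> M i"
    then obtain z where z: "\<And>i n. x \<in> S i n (z i) \<omega>"
      using M[OF \<omega>] by metis
    have "x \<in> R n (\<lambda>p. z (fst (prod_decode p)) (snd (prod_decode p))) \<omega>" for n
      using z by (simp add: R_def)
    then show "\<exists>z. \<forall>n. x \<in> R n z \<omega>" by (intro exI allI)
  next
    assume "\<exists>z. \<forall>n. x \<in> R n z \<omega>"
    then obtain z where "x \<in> R (prod_encode (i, j)) z \<omega>" for i j by blast
    then show "\<forall>i. (\<omega>, x) \<in> M i"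
      unfolding R_enc M[OF \<omega>] by (intro allI exI)
  qed
  with R show ?thesis unfolding suslin_def by auto
qed

lemma suslin_Un:
  assumes "suslin N A" "suslin N B"
  shows "suslin N (A \<union> B)"
proof -
  have "suslin N (\<Union>i::nat. if i = 0 then A else B)"
    using assms by (intro suslin_Union) auto
  moreover have "(\<Union>i::nat. if i = 0 then A else B) = A \<union> B"
    by (auto split: if_splits)
  ultimately show ?thesis by simp
qed

lemma open_eq_Union_closed:
  fixes U :: "real set"
  assumes "open U"
  obtains C :: "nat \<Rightarrow> real set" where "\<And>n. closed (C n)" "U = (\<Union>n. C n)"
proof -
  have "fsigma_in euclidean U"
    using assms by (intro open_imp_fsigma_in metrizable_space_euclidean) simp
  then show thesis using that unfolding fsigma_in_ascending by auto
qed

text \<open>Suslin sets are not closed under complements in general, so the induction carries a set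
  together with its complement. For a closed rectangle the complement is handled by writing an open
  set as a countable union of closed ones.\<close>

lemma suslin_measurable:
  assumes "M \<in> sets (N \<Otimes>\<^sub>M (borel :: real measure))"
  shows "suslin N M"
proof -
  let ?G = "{F \<times> C |F C. F \<in> sets N \<and> C \<in> {C. closed (C :: real set)}}"
  have "sets (N \<Otimes>\<^sub>M (borel :: real measure)) = sets (sigma (space N \<times> space borel) ?G)"
  proof (rule sets_pair_eq[where Ca = "{space N}" and Cb = "{UNIV}"])
    show "sets (borel :: real measure) = sigma_sets (space borel) {C. closed C}"
      by (subst borel_eq_closed) simp
  qed (use sets.space_closed in \<open>auto simp: sets.sigma_sets_eq\<close>)
  also have "\<dots> = sigma_sets (space N \<times> UNIV) ?G"
    using sets.space_closed[of N] by (subst sets_measure_of) auto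
  finally have "M \<in> sigma_sets (space N \<times> UNIV) ?G" using assms by simp
  then have "suslin N M \<and> suslin N (space N \<times> UNIV - M)"
  proof induction
    case (Basic a)
    then obtain F C where a: "a = F \<times> C" "F \<in> sets N" "closed C" by auto
    obtain D where D: "\<And>n. closed (D n :: real set)" "- C = (\<Union>n::nat. D n)"
      using open_eq_Union_closed[of "- C"] a by (auto simp: open_Compl)
    have "space N \<times> UNIV - a = ((space N - F) \<times> UNIV) \<union> (\<Union>n::nat. space N \<times> D n)"
      using D(2) a(1) by (auto simp: set_eq_iff)
    moreover have "suslin N \<dots>"
      using D a by (intro suslin_Un suslin_Union suslin_closed_rectangle) auto
    ultimately show ?case using a suslin_closed_rectangle by metis
  next
    case Empty
    then show ?case
      using suslin_closed_rectangle[of "{}" N "{}"] suslin_closed_rectangle[of "space N" N UNIV] by auto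
  next
    case (Compl a)
    have "suslin N (space N \<times> UNIV - (space N \<times> UNIV - a))"
      using Compl.IH unfolding suslin_def by auto
    then show ?case using Compl.IH by simp
  next
    case (Union a)
    have "space N \<times> UNIV - (\<Union>i. a i) = (\<Inter>i. space N \<times> UNIV - a i)" by auto
    then show ?case using Union.IH suslin_Union[of N a] suslin_Inter[of N "\<lambda>i. space N \<times> UNIV - a i"] by auto
  qed
  then show ?thesis ..
qed

section \<open>Compactness of bounded branches, capacitability and projection\<close>

text \<open>The bounded prefixes form a finitely branching tree. A prefix is \<open>good\<close> if
  it extends to bounded approximations of every depth, and a good prefix has a good one-step
  extension.\<close>

lemma koenig_bounded_branch:
  fixes m :: "nat \<Rightarrow> nat"
  assumes "\<And>k. \<exists>z. (\<forall>i<k. z i \<le> m i) \<and> (\<forall>n\<le>k. P n z)"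
    and dep: "\<And>n z z'. (\<forall>i<n. z i = z' i) \<Longrightarrow> P n z \<Longrightarrow> P n z'"
  shows "\<exists>z. \<forall>n. P n z"
proof -
  define good where "good k z \<longleftrightarrow>
    (\<forall>K. \<exists>z'. (\<forall>i<k. z' i = z i) \<and> (\<forall>i<K. z' i \<le> m i) \<and> (\<forall>n\<le>K. P n z'))" for k and z :: "nat \<Rightarrow> nat"
  have step: "\<exists>j. good (Suc k) (z(k := j))" if gd: "good k z" for k z
  proof (rule ccontr)
    assume "\<not> ?thesis"
    then obtain K where K: "\<And>j z'. (\<forall>i<Suc k. z' i = (z(k := j)) i) \<Longrightarrow>
        (\<forall>i<K j. z' i \<le> m i) \<Longrightarrow> (\<forall>n\<le>K j. P n z') \<Longrightarrow> False"
      unfolding good_def by metis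
    \<comment> \<open>Beyond the failure depths of all finitely many candidates;
      \<open>Suc k\<close> is included so that the bound on coordinate \<open>k\<close> applies to
      \<open>z'\<close>.\<close>
    define L where "L = Max (insert (Suc k) (K ` {..m k}))"
    obtain z' where z': "\<forall>i<k. z' i = z i" "\<forall>i<L. z' i \<le> m i" "\<forall>n\<le>L. P n z'"
      using gd[unfolded good_def, THEN spec, of L] by (elim exE conjE)
    have "Suc k \<le> L" by (simp add: L_def)
    then have "z' k \<le> m k" using z' by simp
    then have "K (z' k) \<le> L" unfolding L_def by (intro Max_ge) auto
    then show False using z' by (intro K[of z' "z' k"]) (auto simp: less_Suc_eq)
  qed
  have "good 0 z" for z using assms(1) by (auto simp: good_def)
  then obtain Z where Z: "\<And>k. good k (Z k)" "\<And>k. \<exists>j. Z (Suc k) = (Z k)(k := j)"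
    using dependent_nat_choice[of good "\<lambda>k z z'. \<exists>j. z' = z(k := j)"] step by metis
  \<comment> \<open>\<open>Z (Suc k)\<close> differs from \<open>Z k\<close> only at
    \<open>k\<close>, so coordinate \<open>i\<close> is final from stage \<open>Suc i\<close>
    on.\<close>
  define z where "z i = Z (Suc i) i" for i
  have z: "Z (i + Suc j) j = z j" for i j
  proof (induction i)
    case (Suc i)
    obtain l where "Z (Suc (i + Suc j)) = (Z (i + Suc j))(i + Suc j := l)"
      using Z(2) by blast
    then show ?case using Suc by simp
  qed (simp add: z_def)
  have "P n z" for n
  proof -
    obtain z' where z': "\<forall>i<n. z' i = Z n i" "P n z'"
      using Z(1)[of n, unfolded good_def, THEN spec, of n] by auto
    have "z' i = z i" if "i < n" for i
      using z[of "n - Suc i" i] z' that by simp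
    then show ?thesis using dep z'(2) by blast
  qed
  then show ?thesis by blast
qed

text \<open>Choquet's capacitability argument: the outer measure of the projection is continuous along increasing
  unions, so the branches can be bounded coordinate by coordinate without dropping below \<open>\<alpha>\<close>; the set of points
  with a branch below the resulting bound \<open>m\<close> is a decreasing intersection of sets with compact sections.\<close>
lemma suslin_projection_inner:
  assumes "finite_measure N" "suslin N M" "compact D"
    and \<alpha>: "\<alpha> < outer_measure_of N {\<omega> \<in> space N. \<exists>x\<in>D. (\<omega>, x) \<in> M}"
  obtains B where "B \<in> sets N" "B \<subseteq> {\<omega> \<in> space N. \<exists>x\<in>D. (\<omega>, x) \<in> M}" "\<alpha> \<le> emeasure N B"
proof -
  interpret finite_measure N by fact
  obtain S where S: "closed_simple_scheme N S"
    and M: "\<And>\<omega> x. \<omega> \<in> space N \<Longrightarrow> (\<omega>, x) \<in> M \<longleftrightarrow> (\<exists>z. \<forall>n. x \<in> S n z \<omega>)"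
    using assms(2) unfolding suslin_def by blast
  have S_simple: "simple_function N (S n z)" and S_closed: "closed (S n z \<omega>)" for n z \<omega>
    using S unfolding closed_simple_scheme_def by auto
  note S_dep = scheme_dep[OF S]
  define Q where "Q k m = {\<omega>\<in>space N. \<exists>x\<in>D. \<exists>z. (\<forall>i<k. z i \<le> m i) \<and> (\<forall>n. x \<in> S n z \<omega>)}"
    for k and m :: "nat \<Rightarrow> nat"
  have Q_mono: "Q k m \<subseteq> Q k m'" if "\<And>i. i < k \<Longrightarrow> m i \<le> m' i" for k m m'
    unfolding Q_def using that by (intro Collect_mono) (meson order_trans)
  have step: "\<exists>j. \<alpha> < outer_measure_of N (Q (Suc k) (m(k := j)))" if "\<alpha> < outer_measure_of N (Q k m)" for k m
  proof -
    have "Q k m = (\<Union>j. Q (Suc k) (m(k := j)))"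
      unfolding Q_def by (auto simp: less_Suc_eq)
    moreover have "incseq (\<lambda>j. Q (Suc k) (m(k := j)))"
      by (intro monoI Q_mono) auto
    moreover have "Q (Suc k) (m(k := j)) \<subseteq> space N" for j by (auto simp: Q_def)
    ultimately have "\<alpha> < (SUP j. outer_measure_of N (Q (Suc k) (m(k := j))))"
      using that SUP_outer_measure_of_incseq[of "\<lambda>j. Q (Suc k) (m(k := j))" N] by simp
    then show ?thesis by (auto simp: less_SUP_iff)
  qed
  have "Q 0 m = {\<omega> \<in> space N. \<exists>x\<in>D. (\<omega>, x) \<in> M}" for m
    using M by (auto simp: Q_def)
  then have "\<alpha> < outer_measure_of N (Q 0 m)" for m using \<alpha> by simp
  then obtain Z where Z: "\<And>k. \<alpha> < outer_measure_of N (Q k (Z k))" "\<And>k. \<exists>j. Z (Suc k) = (Z k)(k := j)"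
    using dependent_nat_choice[of "\<lambda>k m. \<alpha> < outer_measure_of N (Q k m)" "\<lambda>k z z'. \<exists>j. z' = z(k := j)"] step
    by metis
  define m where "m i = Z (Suc i) i" for i
  have m: "Z (i + Suc j) j = m j" for i j
  proof (induction i)
    case (Suc i)
    obtain l where "Z (Suc (i + Suc j)) = (Z (i + Suc j))(i + Suc j := l)"
      using Z(2) by blast
    then show ?case using Suc by simp
  qed (simp add: m_def)
  have Zm: "Z k i = m i" if "i < k" for i k
    using m[of "k - Suc i" i] that by simp
  \<comment> \<open>\<open>Q\<close> demands a whole branch, \<open>E\<close> only the levels up to
    \<open>k\<close>: the former carries the outer measure, the latter is compact and yields
    measurable events.\<close>
  define E where "E k \<omega> = {x\<in>D. \<exists>z. (\<forall>i<k. z i \<le> m i) \<and> (\<forall>n\<le>k. x \<in> S n z \<omega>)}" for k \<omega>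
  \<comment> \<open>Levels up to \<open>k\<close> ignore the coordinates from \<open>k\<close> on,
    so padding with 0 leaves finitely many representatives.\<close>
  define F where "F k = {z :: nat \<Rightarrow> nat. (\<forall>i<k. z i \<le> m i) \<and> (\<forall>i\<ge>k. z i = 0)}" for k
  have "finite (F k)" for k
  proof -
    have "F k \<subseteq> (\<lambda>g i. if i < k then g i else 0) ` (Pi\<^sub>E {..<k} (\<lambda>i. {..m i}))"
    proof
      fix z assume "z \<in> F k"
      then show "z \<in> (\<lambda>g i. if i < k then g i else 0) ` (Pi\<^sub>E {..<k} (\<lambda>i. {..m i}))"
        by (intro image_eqI[of _ _ "restrict z {..<k}"]) (auto simp: F_def fun_eq_iff)
    qed
    then show ?thesis by (rule finite_subset) (auto intro!: finite_PiE)
  qed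
  note finF = this
  have E_eq: "E k \<omega> = (\<Union>z\<in>F k. D \<inter> (\<Inter>n\<le>k. S n z \<omega>))" for k \<omega>
  proof (intro set_eqI iffI)
    fix x assume "x \<in> E k \<omega>"
    then obtain z where z: "x \<in> D" "\<forall>i<k. z i \<le> m i" "\<forall>n\<le>k. x \<in> S n z \<omega>" by (auto simp: E_def)
    define z' where "z' i = (if i < k then z i else 0)" for i
    have "S n z = S n z'" if "n \<le> k" for n using that by (intro S_dep) (auto simp: z'_def)
    then have "x \<in> D \<inter> (\<Inter>n\<le>k. S n z' \<omega>)" using z by auto
    moreover have "z' \<in> F k" using z by (auto simp: F_def z'_def)
    ultimately show "x \<in> (\<Union>z\<in>F k. D \<inter> (\<Inter>n\<le>k. S n z \<omega>))" by blast
  qed (auto simp: E_def F_def)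
  have E_compact: "compact (E k \<omega>)" for k \<omega>
    unfolding E_eq using finF assms(3) by (intro compact_UN compact_Int_closed closed_INT S_closed ballI)
  have "simple_function N (\<lambda>\<omega>. \<Inter>n\<le>k. S n z \<omega>)" for k z
  proof (induction k)
    case (Suc k)
    then show ?case
      using simple_function_compose2[OF Suc S_simple[of "Suc k" z], where h = "(\<inter>)"]
      by (simp add: atMost_Suc Int_commute)
  qed (simp add: S_simple)
  note simple_INT = this
  define C where "C k = {\<omega>\<in>space N. E k \<omega> \<noteq> {}}" for k
  have "{\<omega>\<in>space N. D \<inter> (\<Inter>n\<le>k. S n z \<omega>) \<noteq> {}} \<in> sets N" for k z
    using simple_functionD(2)[OF simple_INT[where k=k and z=z], of "{Y. D \<inter> Y \<noteq> {}}"]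
    by (simp add: vimage_def Int_def conj_commute)
  moreover have "C k = (\<Union>z\<in>F k. {\<omega>\<in>space N. D \<inter> (\<Inter>n\<le>k. S n z \<omega>) \<noteq> {}})" for k
    by (auto simp: C_def E_eq)
  ultimately have C_sets: "C k \<in> sets N" for k
    using finF by auto
  have E_mono: "E k' \<omega> \<subseteq> E k \<omega>" if "k \<le> k'" for k k' \<omega>
    using that unfolding E_def by (auto intro: order_trans less_le_trans)
  have "Q k (Z k) \<subseteq> C k" for k
  proof
    fix \<omega> assume "\<omega> \<in> Q k (Z k)"
    then obtain x z where "\<omega> \<in> space N" "x \<in> D" "\<And>i. i < k \<Longrightarrow> z i \<le> m i" "\<And>n. x \<in> S n z \<omega>"
      unfolding Q_def by (auto simp: Zm)
    then show "\<omega> \<in> C k" by (auto simp: C_def E_def)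
  qed
  then have C_ge: "\<alpha> \<le> emeasure N (C k)" for k
    using Z(1)[of k] outer_measure_of_mono[of "Q k (Z k)" "C k" N] C_sets by simp
  show thesis
  proof
    show "(\<Inter>k. C k) \<in> sets N" using C_sets by auto
    have "decseq C" using E_mono unfolding decseq_def C_def by blast
    then have "(INF k. emeasure N (C k)) = emeasure N (\<Inter>k. C k)"
      using C_sets by (intro INF_emeasure_decseq) auto
    then show "\<alpha> \<le> emeasure N (\<Inter>k. C k)"
      using C_ge by (metis INF_greatest)
    show "(\<Inter>k. C k) \<subseteq> {\<omega> \<in> space N. \<exists>x\<in>D. (\<omega>, x) \<in> M}"
    proof
      fix \<omega> assume \<omega>: "\<omega> \<in> (\<Inter>k. C k)"
      then have sp: "\<omega> \<in> space N" by (auto simp: C_def)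
      have "(\<Inter>k. E k \<omega>) \<noteq> {}"
        using \<omega> E_compact E_mono by (intro compact_nest) (auto simp: C_def)
      then obtain x where x: "\<And>k. x \<in> E k \<omega>" by blast
      have "\<exists>z. \<forall>n. x \<in> S n z \<omega>"
      proof (rule koenig_bounded_branch)
        show "\<exists>z. (\<forall>i<k. z i \<le> m i) \<and> (\<forall>n\<le>k. x \<in> S n z \<omega>)" for k
          using x[of k] by (auto simp: E_def)
      qed (metis S_dep)
      then have "(\<omega>, x) \<in> M" using M[OF sp] by simp
      then show "\<omega> \<in> {\<omega> \<in> space N. \<exists>x\<in>D. (\<omega>, x) \<in> M}" using x[of 0] sp by (auto simp: E_def)
    qed
  qed
qed

text \<open>Over a compact set the outer measure of the projection is approached by measurable
  subsets, so the projection lies between a countable union of these and a measurable hull of the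
  same finite measure. The line is exhausted by compact intervals.\<close>

theorem measurable_projection:
  assumes "finite_measure N" and M: "M \<in> sets (N \<Otimes>\<^sub>M (borel :: real measure))"
  shows "{\<omega> \<in> space N. \<exists>x. (\<omega>, x) \<in> M} \<in> sets (completion N)"
proof -
  interpret finite_measure N by fact
  have compact_case: "{\<omega> \<in> space N. \<exists>x\<in>D. (\<omega>, x) \<in> M} \<in> sets (completion N)" (is "?P \<in> _")
    if D: "compact D" for D
  proof -
    let ?o = "outer_measure_of N ?P"
    obtain H where H: "H \<in> sets N" "?P \<subseteq> H" "?o = emeasure N H"
      using outer_measure_of_attain[of ?P N] by auto
    let ?\<B> = "{B\<in>sets N. B \<subseteq> ?P}"
    have "?o \<le> (SUP B\<in>?\<B>. emeasure N B)"
    proof (rule dense_le)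
      fix \<alpha> assume "\<alpha> < ?o"
      then obtain B where "B \<in> ?\<B>" "\<alpha> \<le> emeasure N B"
        using suslin_projection_inner[OF assms(1) suslin_measurable[OF M] D] by blast
      then show "\<alpha> \<le> (SUP B\<in>?\<B>. emeasure N B)" by (rule SUP_upper2)
    qed
    moreover have "?\<B> \<noteq> {}" by (auto intro: exI[of _ "{}"])
    ultimately obtain f :: "nat \<Rightarrow> ennreal" where f: "range f \<subseteq> emeasure N ` ?\<B>" "?o \<le> (SUP i. f i)"
      using ennreal_SUP_countable_SUP[of ?\<B> "emeasure N"] by auto
    then have "\<forall>i. \<exists>B. B \<in> ?\<B> \<and> f i = emeasure N B" by blast
    from choice[OF this] obtain B where B: "\<forall>i. B i \<in> ?\<B> \<and> f i = emeasure N (B i)" ..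
    define U where "U = (\<Union>i. B i)"
    have U: "U \<in> sets N" "U \<subseteq> ?P" using B by (auto simp: U_def)
    have "(SUP i. f i) \<le> emeasure N U"
      using B U by (intro SUP_least) (auto simp: U_def intro!: emeasure_mono)
    then have "emeasure N H \<le> emeasure N U" using f H by simp
    then have "emeasure N (H - U) = 0"
      using U H by (subst emeasure_Diff) (auto simp: diff_eq_0_iff_ennreal less_top[symmetric])
    then have "H - U \<in> null_sets N" using H U by auto
    moreover have "?P = U \<union> (?P - U)" "?P - U \<subseteq> H - U" using U H by auto
    ultimately show ?thesis using U(1) by (intro sets_completionI)
  qed
  have "{\<omega> \<in> space N. \<exists>x. (\<omega>, x) \<in> M} = (\<Union>n::nat. {\<omega> \<in> space N. \<exists>x\<in>{-real n..real n}. (\<omega>, x) \<in> M})"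
  proof -
    have "\<exists>n::nat. x \<in> {-real n..real n}" for x :: real
    proof -
      obtain n where "\<bar>x\<bar> \<le> real n" using real_arch_simple by blast
      then show ?thesis by (intro exI[of _ n]) (simp add: abs_le_iff minus_le_iff)
    qed
    then show ?thesis by blast
  qed
  also have "\<dots> \<in> sets (completion N)"
    by (intro sets.countable_UN) (auto intro!: compact_case)
  finally show ?thesis .
qed

section \<open>The Euler scheme for additive noise\<close>

text \<open>Explicit Euler with step \<open>h\<close>. The noise is additive, so its increments
  enter without error, and each iterate reads finitely many values of the path.\<close>

fun euler :: "(real \<Rightarrow> real \<Rightarrow> real) \<Rightarrow> real \<Rightarrow> (real \<Rightarrow> real) \<Rightarrow> real \<Rightarrow> real \<Rightarrow> real \<Rightarrow> nat \<Rightarrow> real" where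
  "euler f \<sigma> \<omega> \<tau> h x 0 = x"
| "euler f \<sigma> \<omega> \<tau> h x (Suc k) = euler f \<sigma> \<omega> \<tau> h x k
     + h * f (\<tau> + real k * h) (euler f \<sigma> \<omega> \<tau> h x k)
     + \<sigma> * (\<omega> (\<tau> + real (Suc k) * h) - \<omega> (\<tau> + real k * h))"

lemma C1_2_continuous:
  assumes "C1_2 f"
  shows "continuous_on UNIV (\<lambda>p. f (fst p) (snd p))"
proof -
  obtain ft fx where "\<And>p. ((\<lambda>q. f (fst q) (snd q)) has_derivative (\<lambda>h. ft p * fst h + fx p * snd h)) (at p)"
    using assms unfolding C1_2_def by blast
  then have "isCont (\<lambda>p. f (fst p) (snd p)) p" for p
    using has_derivative_continuous by blast
  then show ?thesis by (simp add: continuous_at_imp_continuous_on)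
qed

text \<open>Mean value theorem, with \<open>fx\<close> bounded on a compact box; the constant is
  raised by 1 to make it positive.\<close>

lemma C1_2_locally_lipschitz:
  fixes a b R :: real
  assumes "C1_2 f"
  obtains L where "L > 0"
    "\<And>t x y. t \<in> {a..b} \<Longrightarrow> \<bar>x\<bar> \<le> R \<Longrightarrow> \<bar>y\<bar> \<le> R \<Longrightarrow> \<bar>f t x - f t y\<bar> \<le> L * \<bar>x - y\<bar>"
proof -
  obtain ft fx where fx: "continuous_on UNIV fx"
    and D: "\<And>p. ((\<lambda>q. f (fst q) (snd q)) has_derivative (\<lambda>h. ft p * fst h + fx p * snd h)) (at p)"
    using assms unfolding C1_2_def by blast
  have "compact (fx ` ({a..b} \<times> {-R..R}))"
    by (intro compact_continuous_image continuous_on_subset[OF fx] compact_Times) auto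
  then obtain B where B: "\<And>p. p \<in> {a..b} \<times> {-R..R} \<Longrightarrow> norm (fx p) \<le> B"
    using compact_imp_bounded bounded_iff by (metis image_eqI)
  show thesis
  proof
    show "0 < \<bar>B\<bar> + 1" by simp
    fix t x y assume t: "t \<in> {a..b}" and xy: "\<bar>x\<bar> \<le> R" "\<bar>y\<bar> \<le> R"
    have der: "((\<lambda>x. f t x) has_field_derivative fx (t, x)) (at x within {-R..R})" for x
    proof -
      have "((\<lambda>x. (t, x)) has_derivative (\<lambda>h. (0, h))) (at x)"
        by (auto intro!: derivative_eq_intros)
      from has_derivative_compose[OF this D[of "(t, x)"]]
      have "((\<lambda>x. f t x) has_derivative (\<lambda>h. fx (t, x) * h)) (at x)" by simp
      then show ?thesis
        by (simp add: has_field_derivative_def has_derivative_at_withinI)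
    qed
    have "norm (f t x - f t y) \<le> (\<bar>B\<bar> + 1) * norm (x - y)"
    proof (rule field_differentiable_bound[OF _ der])
      show "norm (fx (t, z)) \<le> \<bar>B\<bar> + 1" if "z \<in> {-R..R}" for z
        using B[of "(t, z)"] t that by auto
    qed (use xy in auto)
    then show "\<bar>f t x - f t y\<bar> \<le> (\<bar>B\<bar> + 1) * \<bar>x - y\<bar>" by simp
  qed
qed

text \<open>Detached from \<open>X\<close>, so that a solution driven by one path can be tested
  against the equation of another.\<close>

definition solves ::
  "(real \<Rightarrow> real \<Rightarrow> real) \<Rightarrow> real \<Rightarrow> (real \<Rightarrow> real) \<Rightarrow> real \<Rightarrow> real \<Rightarrow> real \<Rightarrow> (real \<Rightarrow> real) \<Rightarrow> bool" where
  "solves f \<sigma> \<omega> \<tau> s x u \<longleftrightarrow> continuous_on {\<tau>..s} u \<and>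
     (\<forall>r\<in>{\<tau>..s}. u r = x + integral {\<tau>..r} (\<lambda>r. f r (u r)) + \<sigma> * (\<omega> r - \<omega> \<tau>))"

text \<open>On the range of the solution the drift is Lipschitz, and the discretisation error stays small
  enough to keep the scheme in a compact neighbourhood of that range, so no global growth condition is needed.\<close>
lemma euler_error:
  assumes f: "C1_2 f" and u: "solves f \<sigma> \<omega> \<tau> s x u" and "\<tau> \<le> s" "\<epsilon> > 0"
  shows "\<forall>\<^sub>F N in sequentially. \<forall>k\<le>N.
     \<bar>euler f \<sigma> \<omega> \<tau> ((s - \<tau>) / real N) x k - u (\<tau> + real k * ((s - \<tau>) / real N))\<bar> \<le> \<epsilon>"
proof -
  have cu: "continuous_on {\<tau>..s} u"
    and eq: "\<And>r. r \<in> {\<tau>..s} \<Longrightarrow> u r = x + integral {\<tau>..r} (\<lambda>r. f r (u r)) + \<sigma> * (\<omega> r - \<omega> \<tau>)"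
    using u by (auto simp: solves_def)
  have "bounded (u ` {\<tau>..s})"
    using cu by (intro compact_imp_bounded compact_continuous_image) auto
  then obtain B where B: "\<And>r. r \<in> {\<tau>..s} \<Longrightarrow> \<bar>u r\<bar> \<le> B"
    unfolding bounded_iff by (metis image_eqI real_norm_def)
  \<comment> \<open>One unit of room: an error of at most 1 keeps the iterates where
    \<open>L\<close> is valid.\<close>
  define R where "R = B + 1"
  obtain L where L: "L > 0" "\<And>t x y. t \<in> {\<tau>..s} \<Longrightarrow> \<bar>x\<bar> \<le> R \<Longrightarrow> \<bar>y\<bar> \<le> R \<Longrightarrow> \<bar>f t x - f t y\<bar> \<le> L * \<bar>x - y\<bar>"
    using C1_2_locally_lipschitz[OF f] by blast
  define g where "g r = f r (u r)" for r
  have cg: "continuous_on {\<tau>..s} g"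
  proof -
    have "continuous_on {\<tau>..s} (\<lambda>r. (r, u r))" using cu by (intro continuous_intros)
    from continuous_on_compose2[OF C1_2_continuous[OF f] this]
    show ?thesis by (simp add: g_def[abs_def])
  qed
  define M where "M = exp (L * (s - \<tau>))"
  define \<epsilon>' where "\<epsilon>' = min \<epsilon> 1"
  \<comment> \<open>Makes the discrete Gronwall bound \<open>\<eta> / L * M\<close> equal to
    \<open>\<epsilon>'\<close>, whose cap at 1 serves the radius \<open>R\<close>.\<close>
  define \<eta> where "\<eta> = \<epsilon>' * L / M"
  have \<eta>: "\<eta> > 0" "\<eta> / L * M = \<epsilon>'" using L assms by (auto simp: \<eta>_def M_def \<epsilon>'_def)
  have "uniformly_continuous_on {\<tau>..s} g"
    using cg by (intro compact_uniformly_continuous) auto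
  then obtain d where d: "d > 0" "\<And>r r'. r \<in> {\<tau>..s} \<Longrightarrow> r' \<in> {\<tau>..s} \<Longrightarrow> dist r' r < d \<Longrightarrow> dist (g r') (g r) < \<eta>"
    using \<eta>(1) unfolding uniformly_continuous_on_def by metis
  have "(\<lambda>N. (s - \<tau>) / real N) \<longlonglongrightarrow> 0" by (intro lim_const_over_n)
  then have "\<forall>\<^sub>F N in sequentially. (s - \<tau>) / real N < d" using d(1) by (rule order_tendstoD(2))
  then show ?thesis using eventually_gt_at_top[of "0::nat"]
  proof eventually_elim
    case (elim N)
    define h where "h = (s - \<tau>) / real N"
    have h: "h \<ge> 0" "h < d" "real N * h = s - \<tau>" using elim assms by (auto simp: h_def)
    define t where "t k = \<tau> + real k * h" for k
    have t: "t k \<in> {\<tau>..s}" if "k \<le> N" for k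
    proof -
      have "real k * h \<le> real N * h" using that h by (intro mult_right_mono) auto
      then show ?thesis using h by (auto simp: t_def)
    qed
    let ?e = "\<lambda>k. euler f \<sigma> \<omega> \<tau> h x k"
    \<comment> \<open>Discrete Gronwall: the noise increments cancel, and a step multiplies the
      error by at most \<open>1 + L * h\<close> and adds at most \<open>\<eta> * h\<close> from the
      oscillation of \<open>g\<close>.\<close>
    have main: "\<bar>?e k - u (t k)\<bar> \<le> \<eta> / L * ((1 + L * h) ^ k - 1)" if "k \<le> N" for k
      using that
    proof (induction k)
      case 0
      have "u \<tau> = x" using eq[of \<tau>] assms by auto
      then show ?case by (simp add: t_def)
    next
      case (Suc k)
      have tk: "t k \<in> {\<tau>..s}" "t (Suc k) \<in> {\<tau>..s}" "t k \<le> t (Suc k)" "t (Suc k) - t k = h"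
        using t[of k] t[of "Suc k"] Suc.prems h by (auto simp: t_def algebra_simps)
      have IH: "\<bar>?e k - u (t k)\<bar> \<le> \<eta> / L * ((1 + L * h) ^ k - 1)" using Suc by simp
      also have "\<dots> \<le> \<eta> / L * M"
      proof -
        have "(1 + L * h) ^ k \<le> exp (L * h) ^ k"
          using L h by (intro power_mono) auto
        also have "\<dots> = exp (L * (real k * h))" by (simp add: exp_of_nat_mult[symmetric] mult_ac)
        also have "\<dots> \<le> M" using tk L by (auto simp: M_def t_def)
        finally show ?thesis using L \<eta> by (intro mult_left_mono) auto
      qed
      also have "\<dots> \<le> 1" using \<eta> by (simp add: \<epsilon>'_def)
      finally have ek: "\<bar>?e k\<bar> \<le> R" using B[OF tk(1)] by (simp add: R_def)
      have intg: "g integrable_on {\<tau>..t (Suc k)}"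
        using tk by (intro integrable_continuous_real continuous_on_subset[OF cg]) auto
      have "integral {\<tau>..t k} g + integral {t k..t (Suc k)} g = integral {\<tau>..t (Suc k)} g"
        using tk intg by (intro Henstock_Kurzweil_Integration.integral_combine) auto
      then have u_step: "u (t (Suc k)) = u (t k) + integral {t k..t (Suc k)} g + \<sigma> * (\<omega> (t (Suc k)) - \<omega> (t k))"
        using eq[OF tk(1)] eq[OF tk(2)] by (simp add: g_def[abs_def] algebra_simps)
      have "norm (integral (cbox (t k) (t (Suc k))) (\<lambda>r. g r - g (t k))) \<le> \<eta> * measure lborel (cbox (t k) (t (Suc k)))"
      proof (rule integrable_bound)
        show "(\<lambda>r. g r - g (t k)) integrable_on cbox (t k) (t (Suc k))"
          using tk by (intro integrable_continuous continuous_intros continuous_on_subset[OF cg]) auto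
        show "norm (g r - g (t k)) \<le> \<eta>" if "r \<in> cbox (t k) (t (Suc k))" for r
          using d(2)[of "t k" r] that tk h by (auto simp: dist_real_def)
      qed (use \<eta> in auto)
      moreover have "integral (cbox (t k) (t (Suc k))) (\<lambda>r. g r - g (t k)) = integral {t k..t (Suc k)} g - h * g (t k)"
        using tk by (subst integral_diff)
          (auto intro!: integrable_continuous_real continuous_on_subset[OF cg])
      ultimately have int: "\<bar>integral {t k..t (Suc k)} g - h * g (t k)\<bar> \<le> \<eta> * h"
        using tk by simp
      have lip: "\<bar>f (t k) (?e k) - g (t k)\<bar> \<le> L * \<bar>?e k - u (t k)\<bar>"
        unfolding g_def using L(2)[OF tk(1) ek, of "u (t k)"] B[OF tk(1)] by (simp add: R_def)
      have "?e (Suc k) - u (t (Suc k)) = (?e k - u (t k)) + h * (f (t k) (?e k) - g (t k))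
          - (integral {t k..t (Suc k)} g - h * g (t k))"
        unfolding u_step by (simp add: t_def algebra_simps)
      also have "\<bar>\<dots>\<bar> \<le> \<bar>?e k - u (t k)\<bar> + h * \<bar>f (t k) (?e k) - g (t k)\<bar> + \<eta> * h"
        using int h abs_mult[of h "f (t k) (?e k) - g (t k)"] by linarith
      also have "\<dots> \<le> \<bar>?e k - u (t k)\<bar> + h * (L * \<bar>?e k - u (t k)\<bar>) + \<eta> * h"
        using lip h by (intro add_left_mono add_right_mono mult_left_mono) auto
      also have "\<dots> = (1 + L * h) * \<bar>?e k - u (t k)\<bar> + \<eta> * h" by (simp add: algebra_simps)
      also have "\<dots> \<le> (1 + L * h) * (\<eta> / L * ((1 + L * h) ^ k - 1)) + \<eta> * h"
        using IH L h by (intro add_right_mono mult_left_mono) auto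
      also have "\<dots> = \<eta> / L * ((1 + L * h) ^ Suc k - 1)" using L by (simp add: field_simps)
      finally show ?case .
    qed
    have "\<bar>?e k - u (t k)\<bar> \<le> \<epsilon>" if k: "k \<le> N" for k
    proof -
      have "(1 + L * h) ^ k \<le> exp (L * h) ^ k" using L h by (intro power_mono) auto
      also have "\<dots> = exp (L * (real k * h))" by (simp add: exp_of_nat_mult[symmetric] mult_ac)
      also have "\<dots> \<le> M" using t[OF k] L by (auto simp: M_def t_def)
      finally have "\<eta> / L * ((1 + L * h) ^ k - 1) \<le> \<eta> / L * M"
        using L \<eta> by (intro mult_left_mono) auto
      then show ?thesis using main[OF k] \<eta>(2) by (simp add: \<epsilon>'_def)
    qed
    then show ?case by (simp add: h_def t_def)
  qed
qed

lemma euler_tendsto: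
  assumes "C1_2 f" "solves f \<sigma> \<omega> \<tau> s x u" "\<tau> \<le> s"
  shows "(\<lambda>N. euler f \<sigma> \<omega> \<tau> ((s - \<tau>) / real N) x N) \<longlonglongrightarrow> u s"
proof (rule LIMSEQ_I)
  fix r :: real assume "r > 0"
  then have "\<forall>\<^sub>F N in sequentially. \<forall>k\<le>N. \<bar>euler f \<sigma> \<omega> \<tau> ((s - \<tau>) / real N) x k
      - u (\<tau> + real k * ((s - \<tau>) / real N))\<bar> \<le> r / 2"
    using assms by (intro euler_error) auto
  then have "\<forall>\<^sub>F N in sequentially. norm (euler f \<sigma> \<omega> \<tau> ((s - \<tau>) / real N) x N - u s) < r"
    using eventually_gt_at_top[of "0::nat"]
  proof eventually_elim
    case (elim N)
    then have "\<bar>euler f \<sigma> \<omega> \<tau> ((s - \<tau>) / real N) x N - u s\<bar> \<le> r / 2"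
      by (auto dest: spec[of _ N])
    then show ?case using \<open>r > 0\<close> by simp
  qed
  then show "\<exists>no. \<forall>n\<ge>no. norm (euler f \<sigma> \<omega> \<tau> ((s - \<tau>) / real n) x n - u s) < r"
    by (simp add: eventually_sequentially)
qed

text \<open>For steps up to \<open>1 / L\<close> one Euler step is nondecreasing in the state on the
  relevant range, and both schemes receive the same noise; the order survives every step and the
  limit. With equal initial values, used in both directions, this also gives uniqueness.\<close>

lemma solves_mono:
  assumes f: "C1_2 f" and u: "solves f \<sigma> \<omega> \<tau> s x u" and v: "solves f \<sigma> \<omega> \<tau> s y v"
    and "\<tau> \<le> s" "x \<le> y"
  shows "u s \<le> v s"
proof -
  have "bounded (u ` {\<tau>..s} \<union> v ` {\<tau>..s})"
    using u v unfolding solves_def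
    by (intro compact_imp_bounded compact_Un compact_continuous_image) auto
  then obtain B where B: "\<And>r. r \<in> {\<tau>..s} \<Longrightarrow> \<bar>u r\<bar> \<le> B" "\<And>r. r \<in> {\<tau>..s} \<Longrightarrow> \<bar>v r\<bar> \<le> B"
    unfolding bounded_iff by (metis UnI1 UnI2 image_eqI real_norm_def)
  \<comment> \<open>\<open>euler_error\<close> with tolerance 1 keeps both schemes within this
    radius.\<close>
  define R where "R = B + 1"
  obtain L where L: "L > 0" "\<And>t x y. t \<in> {\<tau>..s} \<Longrightarrow> \<bar>x\<bar> \<le> R \<Longrightarrow> \<bar>y\<bar> \<le> R \<Longrightarrow> \<bar>f t x - f t y\<bar> \<le> L * \<bar>x - y\<bar>"
    using C1_2_locally_lipschitz[OF f] by blast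
  have "(\<lambda>N. (s - \<tau>) / real N) \<longlonglongrightarrow> 0" by (intro lim_const_over_n)
  then have "\<forall>\<^sub>F N in sequentially. (s - \<tau>) / real N < 1 / L"
    using L by (intro order_tendstoD(2)) auto
  then have "\<forall>\<^sub>F N in sequentially. euler f \<sigma> \<omega> \<tau> ((s - \<tau>) / real N) x N
      \<le> euler f \<sigma> \<omega> \<tau> ((s - \<tau>) / real N) y N"
    using eventually_gt_at_top[of "0::nat"] euler_error[OF f u \<open>\<tau> \<le> s\<close> zero_less_one]
      euler_error[OF f v \<open>\<tau> \<le> s\<close> zero_less_one]
  proof eventually_elim
    case (elim N)
    define h where "h = (s - \<tau>) / real N"
    have h: "h \<ge> 0" "h * L \<le> 1" "real N * h = s - \<tau>"
      using elim assms L by (auto simp: h_def field_simps)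
    let ?e = "euler f \<sigma> \<omega> \<tau> h"
    have "?e x k \<le> ?e y k" if "k \<le> N" for k
      using that
    proof (induction k)
      case (Suc k)
      let ?t = "\<tau> + real k * h"
      have "real k * h \<le> real N * h" using Suc h by (intro mult_right_mono) auto
      then have t: "?t \<in> {\<tau>..s}" using h by auto
      have "\<bar>?e x k\<bar> \<le> R" "\<bar>?e y k\<bar> \<le> R"
        using elim(3,4) Suc.prems B[OF t] by (auto simp: h_def R_def dest!: spec[of _ k])
      then have "\<bar>f ?t (?e x k) - f ?t (?e y k)\<bar> \<le> L * (?e y k - ?e x k)"
        using L(2)[OF t, of "?e x k" "?e y k"] Suc by simp
      then have "h * \<bar>f ?t (?e x k) - f ?t (?e y k)\<bar> \<le> h * (L * (?e y k - ?e x k))"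
        using h by (intro mult_left_mono) auto
      also have "\<dots> \<le> 1 * (?e y k - ?e x k)"
        unfolding mult.assoc[symmetric] using h Suc by (intro mult_right_mono) auto
      finally have "h * (f ?t (?e x k) - f ?t (?e y k)) \<le> ?e y k - ?e x k"
        using h abs_ge_self[of "h * (f ?t (?e x k) - f ?t (?e y k))"] by (simp add: abs_mult)
      then show ?case by (simp add: right_diff_distrib)
    qed (use \<open>x \<le> y\<close> in simp)
    then show ?case by (simp add: h_def)
  qed
  then show ?thesis
    using euler_tendsto[OF f u \<open>\<tau> \<le> s\<close>] euler_tendsto[OF f v \<open>\<tau> \<le> s\<close>]
    by (intro tendsto_le[OF sequentially_bot, rotated -1]) 
qed

section \<open>Shifting and gluing Wiener paths\<close>

lemma wshift_Omega0: "\<omega> \<in> Omega0 \<Longrightarrow> wshift t \<omega> \<in> Omega0"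
  unfolding Omega0_def wshift_def
  by (auto intro!: continuous_intros continuous_on_compose2[of UNIV \<omega>])

lemma wshift_diff: "wshift t \<omega> a - wshift t \<omega> b = \<omega> (a + t) - \<omega> (b + t)"
  by (simp add: wshift_def)

lemma wshift_wshift: "wshift s (wshift t \<omega>) = wshift (s + t) \<omega>"
  by (simp add: wshift_def fun_eq_iff add_ac)

lemma wshift_0: "\<omega> \<in> Omega0 \<Longrightarrow> wshift 0 \<omega> = \<omega>"
  by (simp add: wshift_def Omega0_def)

text \<open>On \<open>Omega0\<close>: the past of the first path followed by the future of the second one.\<close>
definition glue :: "(real \<Rightarrow> real) \<times> (real \<Rightarrow> real) \<Rightarrow> real \<Rightarrow> real" where
  "glue p s = fst p (min s 0) + snd p (max s 0)"

lemma glue_Omega0: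
  assumes "fst p \<in> Omega0" "snd p \<in> Omega0" shows "glue p \<in> Omega0"
proof -
  have "continuous_on UNIV (\<lambda>s. fst p (min s 0))" "continuous_on UNIV (\<lambda>s. snd p (max s 0))"
    using assms unfolding Omega0_def
    by (auto intro!: continuous_intros continuous_on_compose2[of UNIV "fst p"] continuous_on_compose2[of UNIV "snd p"])
  then show ?thesis
    using assms by (auto simp: Omega0_def glue_def[abs_def] intro!: continuous_on_add)
qed

lemma glue_neg: "snd p \<in> Omega0 \<Longrightarrow> s \<le> 0 \<Longrightarrow> glue p s = fst p s"
  and glue_pos: "fst p \<in> Omega0 \<Longrightarrow> 0 \<le> s \<Longrightarrow> glue p s = snd p s"
  by (auto simp: glue_def Omega0_def)

abbreviation incr :: "real list \<Rightarrow> nat \<Rightarrow> (real \<Rightarrow> real) \<Rightarrow> real" where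
  "incr ts i \<omega> \<equiv> \<omega> (ts ! Suc i) - \<omega> (ts ! i)"

definition incr_law :: "real list \<Rightarrow> nat \<Rightarrow> real measure" where
  "incr_law ts i = density lborel (\<lambda>y. ennreal (normal_density 0 (sqrt (ts ! Suc i - ts ! i)) y))"

lemma prob_space_incr_law:
  assumes "sorted_wrt (<) ts" "i < length ts - 1"
  shows "prob_space (incr_law ts i)"
proof -
  have "ts ! i < ts ! Suc i" using sorted_wrt_nth_less[OF assms(1), of i "Suc i"] assms(2) by simp
  then show ?thesis
    unfolding incr_law_def by (intro prob_space_normal_density) auto
qed

section \<open>Uniqueness of Wiener measure and its invariance under shifting and gluing\<close>

locale wiener_space = prob_space W for W :: "(real \<Rightarrow> real) measure" +
  assumes wiener: "wiener_measure W"
begin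

lemma space_W: "space W = Omega0"
  and sets_W: "sets W = sets (restrict_space (Pi\<^sub>M UNIV (\<lambda>_. borel)) Omega0)"
  using wiener by (auto simp: wiener_measure_def)

lemma measurable_eval [measurable]: "(\<lambda>\<omega>. \<omega> t) \<in> borel_measurable W"
proof -
  have "(\<lambda>\<omega>. \<omega> t) \<in> restrict_space (Pi\<^sub>M UNIV (\<lambda>_. borel)) Omega0 \<rightarrow>\<^sub>M (borel :: real measure)"
    by (intro measurable_restrict_space1 measurable_component_singleton) auto
  then show ?thesis using measurable_cong_sets[OF sets_W refl] by blast
qed

lemma measurable_into_W:
  assumes "\<And>x. x \<in> space M \<Longrightarrow> g x \<in> Omega0" "\<And>t. (\<lambda>x. g x t) \<in> borel_measurable M"
  shows "g \<in> M \<rightarrow>\<^sub>M W"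
proof -
  have "g \<in> M \<rightarrow>\<^sub>M restrict_space (Pi\<^sub>M UNIV (\<lambda>_. borel)) Omega0"
    using assms by (intro measurable_restrict_space2 measurable_PiM_single') auto
  then show ?thesis using measurable_cong_sets[OF refl sets_W] by blast
qed

lemma measurable_wshift [measurable]: "wshift t \<in> W \<rightarrow>\<^sub>M W"
  by (intro measurable_into_W) (auto simp: space_W wshift_Omega0, simp add: wshift_def)

lemma measurable_glue [measurable]: "glue \<in> W \<Otimes>\<^sub>M W \<rightarrow>\<^sub>M W"
  by (intro measurable_into_W) (auto simp: space_W space_pair_measure glue_Omega0, simp add: glue_def)

lemma incr_box:
  assumes ts: "sorted_wrt (<) ts" and A: "\<And>i. i < length ts - 1 \<Longrightarrow> A i \<in> sets borel"
  shows "emeasure W {\<omega>\<in>space W. \<forall>i<length ts - 1. incr ts i \<omega> \<in> A i} =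
    (\<Prod>i<length ts - 1. emeasure (incr_law ts i) (A i))"
\<comment> \<open>Fewer than two times leave no increments, and independence is evaluated over
  nonempty index sets.\<close>
proof (cases "length ts - 1 = 0")
  case False
  let ?n = "length ts - 1"
  have indep: "indep_vars (\<lambda>_. borel) (incr ts) {..<?n}"
    and D: "\<And>i. i < ?n \<Longrightarrow> distributed W lborel (incr ts i) (\<lambda>y. ennreal (normal_density 0 (sqrt (ts ! Suc i - ts ! i)) y))"
    using wiener ts unfolding wiener_measure_def by blast+
  have "{\<omega>\<in>space W. \<forall>i<?n. incr ts i \<omega> \<in> A i} = (\<Inter>i\<in>{..<?n}. incr ts i -` A i \<inter> space W)"
    using False by (auto simp: lessThan_empty_iff)
  moreover have "prob (\<Inter>i\<in>{..<?n}. incr ts i -` A i \<inter> space W) = (\<Prod>i<?n. prob (incr ts i -` A i \<inter> space W))"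
    using False A by (intro indep_varsD[OF indep]) (auto simp: lessThan_empty_iff)
  ultimately have "emeasure W {\<omega>\<in>space W. \<forall>i<?n. incr ts i \<omega> \<in> A i}
      = ennreal (\<Prod>i<?n. prob (incr ts i -` A i \<inter> space W))"
    by (simp only: emeasure_eq_measure)
  also have "\<dots> = (\<Prod>i<?n. emeasure W (incr ts i -` A i \<inter> space W))"
    by (simp add: emeasure_eq_measure prod_ennreal)
  also have "\<dots> = (\<Prod>i<?n. emeasure (incr_law ts i) (A i))"
  proof (intro prod.cong refl)
    fix i assume i: "i \<in> {..<?n}"
    have "incr_law ts i = distr W lborel (incr ts i)"
      using D[of i] i by (simp add: incr_law_def distributed_distr_eq_density)
    then show "emeasure W (incr ts i -` A i \<inter> space W) = emeasure (incr_law ts i) (A i)"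
      using A[of i] i by (simp add: emeasure_distr)
  qed
  finally show ?thesis .
qed (simp add: emeasure_space_1)

text \<open>Boxes fix the joint law of the increments. Paths vanish at 0, so if 0 is among the times
  all values are recovered from increments. Any finite set of times can be enlarged by 0, and
  testing only such lists is what suits \<open>glue\<close>.\<close>

lemma wiener_unique:
  assumes "prob_space N" and sets_N: "sets N = sets W"
    and box: "\<And>ts A. sorted_wrt (<) ts \<Longrightarrow> 0 \<in> set ts \<Longrightarrow> (\<And>i. A i \<in> sets borel) \<Longrightarrow>
      emeasure N {\<omega>\<in>space N. \<forall>i<length ts - 1. incr ts i \<omega> \<in> A i} =
      (\<Prod>i<length ts - 1. emeasure (incr_law ts i) (A i))"
  shows "N = W"
proof -
  interpret N: prob_space N by fact
  have space_N: "space N = Omega0" using sets_eq_imp_space_eq[OF sets_N] space_W by simp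
  define vec where "vec ts \<omega> = (\<lambda>i\<in>{..<length ts - 1}. incr ts i \<omega>)" for ts \<omega>
  have vec_meas: "vec ts \<in> M \<rightarrow>\<^sub>M Pi\<^sub>M {..<length ts - 1} (\<lambda>_. borel)"
    if "sets M = sets W" for ts and M :: "(real \<Rightarrow> real) measure"
    unfolding vec_def measurable_cong_sets[OF that refl] by measurable
  have law: "distr M (Pi\<^sub>M {..<length ts - 1} (\<lambda>_. borel)) (vec ts) = Pi\<^sub>M {..<length ts - 1} (incr_law ts)"
    if ts: "sorted_wrt (<) ts" and M: "sets M = sets W"
      and boxM: "\<And>A. (\<And>i. A i \<in> sets borel) \<Longrightarrow>
      emeasure M {\<omega>\<in>space M. \<forall>i<length ts - 1. incr ts i \<omega> \<in> A i} =
      (\<Prod>i<length ts - 1. emeasure (incr_law ts i) (A i))" for ts M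
  proof -
    let ?n = "length ts - 1"
    \<comment> \<open>Indices out of range get a dummy probability measure, as the product locale
      asks for sigma-finiteness at every index.\<close>
    define L where "L i = (if i < ?n then incr_law ts i else return borel 0)" for i
    have L: "prob_space (L i)" "sets (L i) = sets borel" for i
      using prob_space_incr_law[OF ts] by (auto simp: L_def prob_space_return) (auto simp: incr_law_def)
    interpret L: product_sigma_finite L
      by (intro product_sigma_finite.intro prob_space_imp_sigma_finite L)
    have "distr M (Pi\<^sub>M {..<?n} (\<lambda>_. borel)) (vec ts) = Pi\<^sub>M {..<?n} L"
    proof (rule L.PiM_eqI)
      fix A assume A: "\<And>i. i \<in> {..<?n} \<Longrightarrow> A i \<in> sets (L i)"
      define B where "B i = (if i < ?n then A i else UNIV)" for i
      have B: "B i \<in> sets borel" for i using A by (auto simp: B_def L)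
      have "vec ts -` (Pi\<^sub>E {..<?n} A) \<inter> space M = {\<omega>\<in>space M. \<forall>i<?n. incr ts i \<omega> \<in> B i}"
        unfolding vec_def vimage_def Int_def mem_Collect_eq restrict_PiE_iff Ball_def lessThan_iff B_def
        by (intro Collect_cong) (simp cong: conj_cong imp_cong add: conj_commute)
      moreover have "Pi\<^sub>E {..<?n} A \<in> sets (Pi\<^sub>M {..<?n} (\<lambda>_. borel))"
        using A by (intro sets_PiM_I_finite) (auto simp: L)
      ultimately have "emeasure (distr M (Pi\<^sub>M {..<?n} (\<lambda>_. borel)) (vec ts)) (Pi\<^sub>E {..<?n} A) =
          (\<Prod>i<?n. emeasure (incr_law ts i) (B i))"
        using boxM[OF B] by (simp only: emeasure_distr[OF vec_meas[OF M]])
      also have "\<dots> = (\<Prod>i<?n. emeasure (L i) (A i))"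
        by (intro prod.cong) (auto simp: B_def L_def)
      finally show "emeasure (distr M (Pi\<^sub>M {..<?n} (\<lambda>_. borel)) (vec ts)) (Pi\<^sub>E {..<?n} A) = \<dots>" .
    qed (auto intro!: sets_PiM_cong simp: L)
    also have "\<dots> = Pi\<^sub>M {..<?n} (incr_law ts)" by (intro PiM_cong) (auto simp: L_def)
    finally show ?thesis .
  qed
  have cyl: "emeasure N {\<omega>\<in>Omega0. \<forall>t\<in>J. \<omega> t \<in> A t} = emeasure W {\<omega>\<in>Omega0. \<forall>t\<in>J. \<omega> t \<in> A t}"
    if J: "finite J" and A: "\<And>t. t \<in> J \<Longrightarrow> A t \<in> sets borel" for J and A :: "real \<Rightarrow> real set"
  proof -
    define ts where "ts = sorted_list_of_set (insert 0 J)"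
    have ts: "sorted_wrt (<) ts" "set ts = insert 0 J"
      unfolding ts_def using J by (simp_all only: strict_sorted_list_of_set set_sorted_list_of_set finite_insert)
    let ?n = "length ts - 1"
    obtain i0 where i0: "i0 < length ts" "ts ! i0 = 0"
      using ts(2) by (metis in_set_conv_nth insertI1)
    \<comment> \<open>Value at the \<open>i\<close>-th time: the increments before it minus those
      before the position \<open>i0\<close> of time 0.\<close>
    define val where "val v i = (\<Sum>j<i. v j) - (\<Sum>j<i0. v j)" for v :: "nat \<Rightarrow> real" and i
    have sum_vec: "(\<Sum>j<i. vec ts \<omega> j) = \<omega> (ts ! i) - \<omega> (ts ! 0)" if "i < length ts" for \<omega> i
      using that by (induction i) (auto simp: vec_def)
    have val: "val (vec ts \<omega>) i = \<omega> (ts ! i)" if "\<omega> \<in> Omega0" "i < length ts" for \<omega> i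
      using that i0 sum_vec[of i \<omega>] sum_vec[of i0 \<omega>] by (simp add: val_def Omega0_def)
    define E where "E = {v\<in>space (Pi\<^sub>M {..<?n} (\<lambda>_. borel)). \<forall>i\<in>{i. i < length ts \<and> ts ! i \<in> J}. val v i \<in> A (ts ! i)}"
    have vm: "(\<lambda>v. val v i) \<in> borel_measurable (Pi\<^sub>M {..<?n} (\<lambda>_. borel))" if "i < length ts" for i
      unfolding val_def using that i0
      by (intro borel_measurable_diff borel_measurable_sum measurable_component_singleton) auto
    have E: "E \<in> sets (Pi\<^sub>M {..<?n} (\<lambda>_. borel))"
      unfolding E_def
    proof (rule sets.sets_Collect_finite_All)
      fix i assume "i \<in> {i. i < length ts \<and> ts ! i \<in> J}"
      then show "{v\<in>space (Pi\<^sub>M {..<?n} (\<lambda>_. borel)). val v i \<in> A (ts ! i)} \<in> sets (Pi\<^sub>M {..<?n} (\<lambda>_. borel))"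
        using measurable_sets[OF vm[of i] A[of "ts ! i"]] by (simp add: vimage_def Int_def conj_commute)
    qed simp
    have pre: "vec ts -` E \<inter> Omega0 = {\<omega>\<in>Omega0. \<forall>t\<in>J. \<omega> t \<in> A t}"
    proof -
      have "(\<forall>i\<in>{i. i < length ts \<and> ts ! i \<in> J}. \<omega> (ts ! i) \<in> A (ts ! i)) \<longleftrightarrow> (\<forall>t\<in>J. \<omega> t \<in> A t)" for \<omega>
        using ts(2) by (auto simp: in_set_conv_nth) (metis in_set_conv_nth insertCI)
      moreover have "vec ts \<omega> \<in> space (Pi\<^sub>M {..<?n} (\<lambda>_. borel))" for \<omega>
        by (auto simp: space_PiM vec_def)
      ultimately show ?thesis by (auto simp: E_def val)
    qed
    have "distr N (Pi\<^sub>M {..<?n} (\<lambda>_. borel)) (vec ts) = distr W (Pi\<^sub>M {..<?n} (\<lambda>_. borel)) (vec ts)"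
      using law[OF ts(1) sets_N] law[OF ts(1) refl] box[OF ts(1)] incr_box[OF ts(1)] ts(2) by simp
    then show ?thesis
      using emeasure_distr[OF vec_meas[OF sets_N] E] emeasure_distr[OF vec_meas[OF refl] E]
      by (simp only: space_N space_W pre)
  qed
  \<comment> \<open>Both measures are pushed to the full product space, where cylinders determine a
    finite measure; every event of \<open>W\<close> is the trace of an event there.\<close>
  let ?P = "Pi\<^sub>M UNIV (\<lambda>_. borel :: real measure) :: (real \<Rightarrow> real) measure"
  have id: "(\<lambda>\<omega>. \<omega>) \<in> M \<rightarrow>\<^sub>M ?P" if "sets M = sets W" for M
    unfolding measurable_cong_sets[OF that refl] measurable_cong_sets[OF sets_W refl]
    by (intro measurable_restrict_space1) simp
  have eq: "distr N ?P (\<lambda>\<omega>. \<omega>) = distr W ?P (\<lambda>\<omega>. \<omega>)"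
  proof (rule measure_eqI_PiM_infinite)
    fix A :: "real \<Rightarrow> real set" and J :: "real set"
    assume J: "finite J" and A: "\<And>i. i \<in> J \<Longrightarrow> A i \<in> sets borel"
    have *: "prod_emb UNIV (\<lambda>_. borel) J (Pi\<^sub>E J A) \<inter> Omega0 = {\<omega>\<in>Omega0. \<forall>t\<in>J. \<omega> t \<in> A t}"
      by (auto simp: prod_emb_def PiE_iff)
    have "prod_emb UNIV (\<lambda>_. borel) J (Pi\<^sub>E J A) \<in> sets ?P"
      using J A by (intro sets_PiM_I) auto
    then show "emeasure (distr N ?P (\<lambda>\<omega>. \<omega>)) (prod_emb UNIV (\<lambda>_. borel) J (Pi\<^sub>E J A)) =
        emeasure (distr W ?P (\<lambda>\<omega>. \<omega>)) (prod_emb UNIV (\<lambda>_. borel) J (Pi\<^sub>E J A))"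
      using cyl[of J A] J A by (simp add: emeasure_distr id sets_N space_N space_W *)
  next
    show "finite_measure (distr N ?P (\<lambda>\<omega>. \<omega>))"
      by (rule N.finite_measure_distr[OF id[OF sets_N]])
  qed auto
  show ?thesis
  proof (rule measure_eqI[OF sets_N])
    fix E assume "E \<in> sets N"
    then obtain F where F: "F \<in> sets ?P" "E = Omega0 \<inter> F"
      unfolding sets_N sets_W sets_restrict_space by auto
    have "emeasure M E = emeasure (distr M ?P (\<lambda>\<omega>. \<omega>)) F" if "sets M = sets W" for M
      using F sets_eq_imp_space_eq[OF that] by (simp add: emeasure_distr id that space_W Int_commute)
    then show "emeasure N E = emeasure W E" using eq sets_N by simp
  qed
qed

text \<open>The shift replaces the times by translated ones, and the Gaussian laws depend only on
  time differences.\<close>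

lemma distr_wshift: "distr W W (wshift t) = W"
proof (rule wiener_unique)
  fix ts :: "real list" and A :: "nat \<Rightarrow> real set"
  assume ts: "sorted_wrt (<) ts" and A: "\<And>i. A i \<in> sets borel"
  let ?us = "map (\<lambda>s. s + t) ts"
  have us: "sorted_wrt (<) ?us" using ts by (simp add: sorted_wrt_map)
  have "{\<omega>\<in>space W. \<forall>i<length ts - 1. incr ts i \<omega> \<in> A i} \<in> sets W" using A by measurable
  then have "emeasure (distr W W (wshift t)) {\<omega>\<in>space W. \<forall>i<length ts - 1. incr ts i \<omega> \<in> A i} =
      emeasure W (wshift t -` {\<omega>\<in>space W. \<forall>i<length ts - 1. incr ts i \<omega> \<in> A i} \<inter> space W)"
    by (rule emeasure_distr[OF measurable_wshift])
  also have "wshift t -` {\<omega>\<in>space W. \<forall>i<length ts - 1. incr ts i \<omega> \<in> A i} \<inter> space W =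
      {\<omega>\<in>space W. \<forall>i<length ?us - 1. incr ?us i \<omega> \<in> A i}"
    by (auto simp: space_W wshift_Omega0 wshift_diff)
  also have "emeasure W \<dots> = (\<Prod>i<length ?us - 1. emeasure (incr_law ?us i) (A i))"
    using A by (intro incr_box us) auto
  also have "\<dots> = (\<Prod>i<length ts - 1. emeasure (incr_law ts i) (A i))"
    by (intro prod.cong) (auto simp: incr_law_def)
  finally show "emeasure (distr W W (wshift t)) {\<omega>\<in>space (distr W W (wshift t)). \<forall>i<length ts - 1. incr ts i \<omega> \<in> A i} =
    (\<Prod>i<length ts - 1. emeasure (incr_law ts i) (A i))" by simp
qed (auto intro: prob_space_distr)

text \<open>As 0 is among the times, no increment straddles it; each is read off one of two
  independent paths, and the box probability factors.\<close>

lemma distr_glue: "distr (W \<Otimes>\<^sub>M W) W glue = W"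
proof (rule wiener_unique)
  interpret WW: pair_prob_space W W ..
  show "prob_space (distr (W \<Otimes>\<^sub>M W) W glue)"
    by (rule WW.prob_space_distr) simp
  fix ts :: "real list" and A :: "nat \<Rightarrow> real set"
  assume ts: "sorted_wrt (<) ts" "0 \<in> set ts" and A: "\<And>i. A i \<in> sets borel"
  let ?n = "length ts - 1"
  obtain i0 where i0: "i0 < length ts" "ts ! i0 = 0"
    using ts(2) by (metis in_set_conv_nth)
  \<comment> \<open>The box is split at time 0, and the free sides are filled with
    \<open>UNIV\<close>, of mass 1.\<close>
  define A1 where "A1 i = (if i < i0 then A i else UNIV)" for i
  define A2 where "A2 i = (if i < i0 then UNIV else A i)" for i
  have A12: "A1 i \<in> sets borel" "A2 i \<in> sets borel" for i using A by (auto simp: A1_def A2_def)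
  let ?B = "\<lambda>A. {\<omega>\<in>space W. \<forall>i<?n. incr ts i \<omega> \<in> A i}"
  have B: "?B A' \<in> sets W" if "\<And>i. A' i \<in> sets borel" for A'
    using that by measurable
  have neg: "ts ! i \<le> 0" if "i \<le> i0" for i
    using sorted_wrt_nth_less[OF ts(1), of i i0] i0 that by (cases "i = i0") auto
  have pos: "ts ! i \<ge> 0" if "i0 \<le> i" "i < length ts" for i
    using sorted_wrt_nth_less[OF ts(1), of i0 i] i0 that by (cases "i = i0") auto
  have incr_glue: "incr ts i (glue (\<omega>1, \<omega>2)) = (if i < i0 then incr ts i \<omega>1 else incr ts i \<omega>2)"
    if "\<omega>1 \<in> Omega0" "\<omega>2 \<in> Omega0" "i < ?n" for \<omega>1 \<omega>2 i
    using that neg[of i] neg[of "Suc i"] pos[of i] pos[of "Suc i"] by (auto simp: glue_neg glue_pos)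
  have pre: "glue -` ?B A \<inter> space (W \<Otimes>\<^sub>M W) = ?B A1 \<times> ?B A2"
    by (auto simp: space_pair_measure space_W glue_Omega0 incr_glue A1_def A2_def split: if_splits)
  have "emeasure (distr (W \<Otimes>\<^sub>M W) W glue) (?B A) = emeasure (W \<Otimes>\<^sub>M W) (?B A1 \<times> ?B A2)"
    using emeasure_distr[OF measurable_glue B[OF A]] by (simp only: pre)
  also have "\<dots> = emeasure W (?B A1) * emeasure W (?B A2)"
    using A12 by (intro emeasure_pair_measure_Times B)
  also have "\<dots> = (\<Prod>i<?n. emeasure (incr_law ts i) (A1 i)) * (\<Prod>i<?n. emeasure (incr_law ts i) (A2 i))"
    by (simp only: incr_box[OF ts(1), of A1, OF A12(1)] incr_box[OF ts(1), of A2, OF A12(2)])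
  also have "\<dots> = (\<Prod>i<?n. emeasure (incr_law ts i) (A i))"
    unfolding prod.distrib[symmetric]
  proof (intro prod.cong refl)
    fix i assume "i \<in> {..<?n}"
    then have "emeasure (incr_law ts i) UNIV = 1"
      using prob_space.emeasure_space_1[OF prob_space_incr_law[OF ts(1), of i]]
      by (simp add: incr_law_def)
    then show "emeasure (incr_law ts i) (A1 i) * emeasure (incr_law ts i) (A2 i) = emeasure (incr_law ts i) (A i)"
      by (simp add: A1_def A2_def)
  qed
  finally show "emeasure (distr (W \<Otimes>\<^sub>M W) W glue) {\<omega>\<in>space (distr (W \<Otimes>\<^sub>M W) W glue). \<forall>i<?n. incr ts i \<omega> \<in> A i} =
      (\<Prod>i<?n. emeasure (incr_law ts i) (A i))" by simp
qed simp

end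

section \<open>The extremal points of the attractor\<close>

text \<open>\<open>arctan\<close> is bounded and strictly increasing, so equal laws give equal
  finite expectations even if \<open>g\<close> and \<open>h\<close> are not integrable; a
  nonnegative difference with integral 0 vanishes almost surely.\<close>

lemma (in prob_space) AE_eq_if_distr_eq:
  fixes g h :: "'a \<Rightarrow> real"
  assumes [measurable]: "g \<in> borel_measurable M" "h \<in> borel_measurable M"
    and le: "AE \<omega> in M. g \<omega> \<le> h \<omega>" and eq: "distr M borel g = distr M borel h"
  shows "AE \<omega> in M. g \<omega> = h \<omega>"
proof -
  have bd: "norm (arctan y) \<le> pi / 2" for y
    using arctan_bounded[of y] unfolding real_norm_def by linarith
  have int: "integrable M (\<lambda>\<omega>. arctan (k \<omega>))" if "k \<in> borel_measurable M" for k
    using that bd by (intro integrable_const_bound[of _ "pi / 2"]) auto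
  have "(\<integral>\<omega>. arctan (k \<omega>) \<partial>M) = (\<integral>y. arctan y \<partial>distr M borel k)" if "k \<in> borel_measurable M" for k
    using that by (subst integral_distr) auto
  then have "(\<integral>\<omega>. arctan (h \<omega>) - arctan (g \<omega>) \<partial>M) = 0"
    using eq by (simp add: int)
  moreover have "AE \<omega> in M. 0 \<le> arctan (h \<omega>) - arctan (g \<omega>)"
    using le by eventually_elim (simp add: arctan_le_iff)
  ultimately have "AE \<omega> in M. arctan (h \<omega>) - arctan (g \<omega>) = 0"
    using integral_nonneg_eq_0_iff_AE[of M "\<lambda>\<omega>. arctan (h \<omega>) - arctan (g \<omega>)"] by (simp add: int)
  then show ?thesis by eventually_elim (simp add: arctan_eq_iff)
qed

text \<open>Recurrence: the events \<open>a \<circ> \<theta> k \<le> n\<close> have the same large probability for every \<open>k\<close>, so a lower bound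
  valid only on them suffices for convergence in probability.\<close>
lemma (in prob_space) approx_in_probability:
  fixes a :: "'a \<Rightarrow> real" and U :: "nat \<Rightarrow> nat \<Rightarrow> 'a \<Rightarrow> real"
  assumes a[measurable]: "a \<in> borel_measurable M" and U[measurable]: "\<And>n k. U n k \<in> borel_measurable M"
    and \<theta>[measurable]: "\<And>k. \<theta> k \<in> M \<rightarrow>\<^sub>M M" and \<theta>_distr: "\<And>k. distr M M (\<theta> k) = M"
    and upper: "\<And>n \<epsilon>. \<epsilon> > 0 \<Longrightarrow> AE \<omega> in M. \<forall>\<^sub>F k in sequentially. U n k \<omega> < a \<omega> + \<epsilon>"
    and lower: "\<And>n k. AE \<omega> in M. a (\<theta> k \<omega>) \<le> real n \<longrightarrow> a \<omega> \<le> U n k \<omega>"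
    and pos: "\<epsilon> > 0" "\<delta> > 0"
  shows "\<exists>n k. prob {\<omega>\<in>space M. \<epsilon> \<le> \<bar>U n k \<omega> - a \<omega>\<bar>} < \<delta>"
proof -
  have "(\<lambda>n. prob {\<omega>\<in>space M. real n < a \<omega>}) \<longlonglongrightarrow> prob (\<Inter>n::nat. {\<omega>\<in>space M. real n < a \<omega>})"
    by (intro finite_Lim_measure_decseq) (auto simp: decseq_def intro: order_le_less_trans[rotated])
  moreover have "(\<Inter>n::nat. {\<omega>\<in>space M. real n < a \<omega>}) = {}"
  proof -
    have "\<exists>n. \<not> real n < a \<omega>" for \<omega>
      using real_arch_simple[of "a \<omega>"] by (simp add: not_less)
    then show ?thesis by blast
  qed
  ultimately have "(\<lambda>n. prob {\<omega>\<in>space M. real n < a \<omega>}) \<longlonglongrightarrow> 0" by simp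
  then have "\<forall>\<^sub>F n in sequentially. prob {\<omega>\<in>space M. real n < a \<omega>} < \<delta> / 2"
    using pos by (intro order_tendstoD(2)) auto
  then obtain n where n: "prob {\<omega>\<in>space M. real n < a \<omega>} < \<delta> / 2"
    by (auto simp: eventually_sequentially)
  define D where "D K = {\<omega>\<in>space M. \<exists>k\<ge>K. a \<omega> + \<epsilon> \<le> U n k \<omega>}" for K
  have D[measurable]: "D K \<in> sets M" for K unfolding D_def by measurable
  have "(\<lambda>K. prob (D K)) \<longlonglongrightarrow> prob (\<Inter>K. D K)"
    by (intro finite_Lim_measure_decseq) (auto simp: decseq_def D_def intro: order_trans)
  moreover have "prob (\<Inter>K. D K) = 0"
  proof (rule prob_eq_0[THEN iffD2])
    show "AE \<omega> in M. \<omega> \<notin> (\<Inter>K. D K)"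
      using upper[OF pos(1), of n]
    proof eventually_elim
      case (elim \<omega>)
      then obtain N where "\<forall>k\<ge>N. U n k \<omega> < a \<omega> + \<epsilon>" by (auto simp: eventually_sequentially)
      then have "\<omega> \<notin> D N" by (auto simp: D_def not_le)
      then show ?case by blast
    qed
  qed measurable
  ultimately have "\<forall>\<^sub>F K in sequentially. prob (D K) < \<delta> / 2"
    using pos by (intro order_tendstoD(2)[of _ 0]) auto
  then obtain k where k: "prob (D k) < \<delta> / 2"
    by (auto simp: eventually_sequentially)
  let ?E = "{\<omega>\<in>space M. real n < a (\<theta> k \<omega>)}"
  have "prob ?E = measure (distr M M (\<theta> k)) {\<omega>\<in>space M. real n < a \<omega>}"
    using measurable_space[OF \<theta>[of k]] by (subst measure_distr) (auto intro!: arg_cong[of _ _ prob])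
  then have E: "prob ?E < \<delta> / 2" using n by (simp add: \<theta>_distr)
  have "prob {\<omega>\<in>space M. \<epsilon> \<le> \<bar>U n k \<omega> - a \<omega>\<bar>} \<le> prob (?E \<union> D k)"
  proof (rule finite_measure_mono_AE)
    show "AE \<omega> in M. \<omega> \<in> {\<omega>\<in>space M. \<epsilon> \<le> \<bar>U n k \<omega> - a \<omega>\<bar>} \<longrightarrow> \<omega> \<in> ?E \<union> D k"
      using lower[of k n]
    proof eventually_elim
      case (elim \<omega>)
      then show ?case using pos by (auto simp: D_def not_less intro!: exI[of _ k])
    qed
  qed measurable
  also have "\<dots> \<le> prob ?E + prob (D k)" by (intro measure_Un_le) measurable
  also have "\<dots> < \<delta>" using E k by simp
  finally show ?thesis by blast
qed

text \<open>The maximum for \<open>c = 1\<close> and the minimum for \<open>c = -1\<close>, so that both boundary points of the attractor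
  are treated at once.\<close>
definition extremum :: "real \<Rightarrow> real set \<Rightarrow> real" where
  "extremum c A = c * Sup ((\<lambda>x. c * x) ` A)"

lemma extremum:
  assumes A: "compact A" "A \<noteq> {}" and c: "c \<in> {1, -1}"
  shows "extremum c A \<in> A" "x \<in> A \<Longrightarrow> c * x \<le> c * extremum c A"
proof -
  have cA: "compact ((\<lambda>x. c * x) ` A)"
    using A by (intro compact_continuous_image continuous_intros)
  have cc: "c * (c * y) = y" for y using c by auto
  have "Sup ((\<lambda>x. c * x) ` A) \<in> (\<lambda>x. c * x) ` A"
    using cA A by (intro closed_contains_Sup bounded_imp_bdd_above compact_imp_bounded compact_imp_closed) auto
  then show "extremum c A \<in> A" using cc unfolding extremum_def by (metis imageE)
  show "x \<in> A \<Longrightarrow> c * x \<le> c * extremum c A"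
    unfolding extremum_def cc using cA by (intro cSup_upper bounded_imp_bdd_above compact_imp_bounded) auto
qed

lemma extremum_eqI:
  assumes "compact A" "c \<in> {1, -1}" "e \<in> A" "\<And>x. x \<in> A \<Longrightarrow> c * x \<le> c * e"
  shows "extremum c A = e"
  using extremum[of A c] assms by (metis antisym empty_iff insertE minus_mult_minus mult_1 mult_minus1 neg_equal_iff_equal)

text \<open>Turns a strict bound on the extremum into the existence of a fibre point in a half-line,
  that is, into a projection.\<close>

lemma extremum_gt_iff:
  assumes "compact A" "A \<noteq> {}" "c \<in> {1, -1}"
  shows "q < c * extremum c A \<longleftrightarrow> (\<exists>x\<in>A. q < c * x)"
  using extremum[OF assms] by (meson less_le_trans)

section \<open>Solutions and cocycle: order, measurability, dependence on past and future
  noise\<close>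

locale additive_noise_sde = wiener_space W for W +
  fixes f :: "real \<Rightarrow> real \<Rightarrow> real" and \<sigma> :: real
    and X :: "real \<Rightarrow> real \<Rightarrow> (real \<Rightarrow> real) \<Rightarrow> real \<Rightarrow> real"
  assumes f_C1: "C1_2 f" and solution: "pathwise_solution f \<sigma> X"
begin

lemma X_solves: "\<omega> \<in> Omega0 \<Longrightarrow> \<tau> \<le> s \<Longrightarrow> solves f \<sigma> \<omega> \<tau> s x (\<lambda>r. X r \<tau> \<omega> x)"
  using solution unfolding pathwise_solution_def solves_def
  by (auto intro: continuous_on_subset[of "{\<tau>..}"])

lemma X_mono: "\<omega> \<in> Omega0 \<Longrightarrow> \<tau> \<le> s \<Longrightarrow> x \<le> y \<Longrightarrow> X s \<tau> \<omega> x \<le> X s \<tau> \<omega> y"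
  using solves_mono[OF f_C1 X_solves X_solves] by blast

text \<open>Only increments from \<open>\<tau>\<close> on enter the integral equation, so the
  solution for \<open>\<omega>\<close> also solves the one for \<open>\<omega>'\<close>; comparison
  in both directions identifies them.\<close>

lemma X_cong_increments:
  assumes "\<omega> \<in> Omega0" "\<omega>' \<in> Omega0" "\<tau> \<le> s"
    and "\<And>r. \<tau> \<le> r \<Longrightarrow> r \<le> s \<Longrightarrow> \<omega> r - \<omega> \<tau> = \<omega>' r - \<omega>' \<tau>"
  shows "X s \<tau> \<omega> x = X s \<tau> \<omega>' x"
proof -
  have "solves f \<sigma> \<omega>' \<tau> s x (\<lambda>r. X r \<tau> \<omega> x)"
    using X_solves[OF assms(1,3), of x] assms(4) by (simp add: solves_def)
  then show ?thesis
    using solves_mono[OF f_C1 _ _ assms(3) order_refl] X_solves[OF assms(2,3), of x] by (blast intro: antisym)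
qed

text \<open>Pointwise limit of Euler iterates, each jointly measurable in path and initial
  value.\<close>

lemma measurable_X:
  assumes "\<tau> \<le> s"
  shows "(\<lambda>p. X s \<tau> (fst p) (snd p)) \<in> borel_measurable (W \<Otimes>\<^sub>M borel)"
proof (rule borel_measurable_LIMSEQ_real)
  show "(\<lambda>N. euler f \<sigma> (fst p) \<tau> ((s - \<tau>) / real N) (snd p) N) \<longlonglongrightarrow> X s \<tau> (fst p) (snd p)"
    if "p \<in> space (W \<Otimes>\<^sub>M borel)" for p
    using that assms by (intro euler_tendsto[OF f_C1 X_solves]) (auto simp: space_pair_measure space_W)
  have f: "f t \<in> borel_measurable borel" for t
  proof -
    have "continuous_on UNIV (\<lambda>x. (t, x))" by (intro continuous_intros)
    from continuous_on_compose2[OF C1_2_continuous[OF f_C1] this]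
    show ?thesis by (intro borel_measurable_continuous_onI) simp
  qed
  have ev: "(\<lambda>p. fst p t) \<in> borel_measurable (W \<Otimes>\<^sub>M (borel :: real measure))" for t
    using measurable_compose[OF measurable_fst measurable_eval] .
  show "(\<lambda>p. euler f \<sigma> (fst p) \<tau> ((s - \<tau>) / real N) (snd p) N) \<in> borel_measurable (W \<Otimes>\<^sub>M borel)" for N
  proof -
    have "(\<lambda>p. euler f \<sigma> (fst p) \<tau> h (snd p) k) \<in> borel_measurable (W \<Otimes>\<^sub>M borel)" for h k
    proof (induction k)
      case (Suc k)
      show ?case
        unfolding euler.simps
        by (intro borel_measurable_add borel_measurable_times borel_measurable_diff borel_measurable_const
            Suc ev measurable_compose[OF Suc f])
    qed simp
    then show ?thesis .
  qed
qed

abbreviation "\<Phi> \<equiv> cocycle X"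

lemma cocycle_mono: "\<omega> \<in> Omega0 \<Longrightarrow> 0 \<le> t \<Longrightarrow> x \<le> y \<Longrightarrow> \<Phi> t \<tau> \<omega> x \<le> \<Phi> t \<tau> \<omega> y"
  unfolding cocycle_def by (intro X_mono wshift_Omega0) auto

lemma cocycle_mono_sign:
  assumes "\<omega> \<in> Omega0" "0 \<le> t" "c \<in> {1, -1}" "c * x \<le> c * y"
  shows "c * \<Phi> t \<tau> \<omega> x \<le> c * \<Phi> t \<tau> \<omega> y"
  using assms cocycle_mono[of \<omega> t x y \<tau>] cocycle_mono[of \<omega> t y x \<tau>] by auto

lemma measurable_cocycle:
  assumes "0 \<le> t"
  shows "(\<lambda>p. \<Phi> t \<tau> (fst p) (snd p)) \<in> borel_measurable (W \<Otimes>\<^sub>M borel)"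
proof -
  have "(\<lambda>p. (wshift (- \<tau>) (fst p), snd p)) \<in> W \<Otimes>\<^sub>M (borel :: real measure) \<rightarrow>\<^sub>M W \<Otimes>\<^sub>M borel" by measurable
  from measurable_compose[OF this measurable_X[of \<tau> "t + \<tau>"]] show ?thesis
    using assms by (simp add: cocycle_def)
qed

lemma measurable_cocycle_compose [measurable (raw)]:
  assumes "0 \<le> t" "g \<in> M \<rightarrow>\<^sub>M W" "h \<in> borel_measurable M"
  shows "(\<lambda>x. \<Phi> t \<tau> (g x) (h x)) \<in> borel_measurable M"
  using measurable_compose[OF measurable_Pair[OF assms(2,3)] measurable_cocycle[OF assms(1), of \<tau>]] by simp

text \<open>After the shift by \<open>- \<tau>\<close> the solution is driven by the increments of
  the path over \<open>{0..t}\<close>, where \<open>glue p\<close> is \<open>snd p\<close>.\<close>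

lemma cocycle_glue_future:
  assumes "fst p \<in> Omega0" "snd p \<in> Omega0" "0 \<le> t"
  shows "\<Phi> t \<tau> (glue p) x = \<Phi> t \<tau> (snd p) x"
  unfolding cocycle_def using assms
  by (intro X_cong_increments wshift_Omega0 glue_Omega0) (auto simp: wshift_diff glue_pos)

text \<open>Here the driving increments lie over \<open>{-t..0}\<close>, where the glued path is
  \<open>fst p\<close>.\<close>

lemma cocycle_glue_past:
  assumes "fst p \<in> Omega0" "snd p \<in> Omega0" "0 \<le> t"
  shows "\<Phi> t (\<tau> - t) (wshift (- t) (glue p)) x = \<Phi> t (\<tau> - t) (wshift (- t) (fst p)) x"
  unfolding cocycle_def using assms
  by (intro X_cong_increments wshift_Omega0 glue_Omega0) (auto simp: wshift_diff wshift_wshift glue_neg)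

lemma AE_wshift: "AE \<omega> in W. P \<omega> \<Longrightarrow> AE \<omega> in W. P (wshift t \<omega>)"
  by (rule AE_distrD[OF measurable_wshift]) (simp only: distr_wshift)

lemma prob_wshift:
  assumes "{\<omega>\<in>space W. P \<omega>} \<in> sets W"
  shows "prob {\<omega>\<in>space W. P (wshift t \<omega>)} = prob {\<omega>\<in>space W. P \<omega>}"
proof -
  have "prob {\<omega>\<in>space W. P \<omega>} = measure (distr W W (wshift t)) {\<omega>\<in>space W. P \<omega>}"
    by (simp add: distr_wshift)
  also have "\<dots> = prob (wshift t -` {\<omega>\<in>space W. P \<omega>} \<inter> space W)"
    by (rule measure_distr[OF measurable_wshift assms])
  also have "wshift t -` {\<omega>\<in>space W. P \<omega>} \<inter> space W = {\<omega>\<in>space W. P (wshift t \<omega>)}"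
    by (auto simp: space_W wshift_Omega0)
  finally show ?thesis by simp
qed

lemma prob_glue:
  assumes "{\<omega>\<in>space W. P \<omega>} \<in> sets W"
  shows "measure (W \<Otimes>\<^sub>M W) {p\<in>space (W \<Otimes>\<^sub>M W). P (glue p)} = prob {\<omega>\<in>space W. P \<omega>}"
proof -
  have "prob {\<omega>\<in>space W. P \<omega>} = measure (distr (W \<Otimes>\<^sub>M W) W glue) {\<omega>\<in>space W. P \<omega>}"
    by (simp add: distr_glue)
  also have "\<dots> = measure (W \<Otimes>\<^sub>M W) (glue -` {\<omega>\<in>space W. P \<omega>} \<inter> space (W \<Otimes>\<^sub>M W))"
    by (rule measure_distr[OF measurable_glue assms])
  also have "glue -` {\<omega>\<in>space W. P \<omega>} \<inter> space (W \<Otimes>\<^sub>M W) = {p\<in>space (W \<Otimes>\<^sub>M W). P (glue p)}"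
    by (auto simp: space_W space_pair_measure glue_Omega0)
  finally show ?thesis by simp
qed

lemma prob_fst:
  assumes "{\<omega>\<in>space W. P \<omega>} \<in> sets W"
  shows "measure (W \<Otimes>\<^sub>M W) {p\<in>space (W \<Otimes>\<^sub>M W). P (fst p)} = prob {\<omega>\<in>space W. P \<omega>}"
proof -
  have "{p\<in>space (W \<Otimes>\<^sub>M W). P (fst p)} = {\<omega>\<in>space W. P \<omega>} \<times> space W"
    by (auto simp: space_pair_measure)
  then show ?thesis
    using assms by (simp add: measure_def emeasure_pair_measure_Times emeasure_space_1)
qed

text \<open>Being determined by the past means being unchanged when the future is replaced by an
  independent one. Both \<open>glue\<close> and \<open>fst\<close> carry
  \<open>W \<Otimes>\<^sub>M W\<close> to \<open>W\<close>, so an approximation in probability is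
  equally good along either, and the triangle inequality passes the identity from \<open>U\<close>
  to \<open>a\<close>.\<close>

lemma AE_glue_eq_fst:
  assumes a[measurable]: "a \<in> borel_measurable W"
    and approx: "\<And>\<epsilon> \<delta>. \<epsilon> > 0 \<Longrightarrow> \<delta> > 0 \<Longrightarrow> \<exists>U\<in>borel_measurable W.
      (\<forall>p\<in>space (W \<Otimes>\<^sub>M W). U (glue p) = U (fst p)) \<and> prob {\<omega>\<in>space W. \<epsilon> \<le> \<bar>U \<omega> - a \<omega>\<bar>} < \<delta>"
  shows "AE p in W \<Otimes>\<^sub>M W. a (glue p) = (a (fst p) :: real)"
proof -
  interpret WW: pair_prob_space W W ..
  have "AE p in W \<Otimes>\<^sub>M W. \<not> 1 / real (Suc m) \<le> \<bar>a (glue p) - a (fst p)\<bar>" for m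
  proof -
    let ?B = "{p\<in>space (W \<Otimes>\<^sub>M W). 1 / real (Suc m) \<le> \<bar>a (glue p) - a (fst p)\<bar>}"
    have B: "?B \<in> sets (W \<Otimes>\<^sub>M W)" by measurable
    have "WW.prob ?B \<le> 0 + \<delta>" if "\<delta> > 0" for \<delta>
    proof -
      define \<epsilon> where "\<epsilon> = 1 / (2 * real (Suc m))"
      have \<epsilon>: "\<epsilon> > 0" "1 / real (Suc m) = 2 * \<epsilon>" by (auto simp: \<epsilon>_def field_simps)
      have half: "\<delta> / 2 > 0" using that by simp
      obtain U where U[measurable]: "U \<in> borel_measurable W"
        and glue: "\<And>p. p \<in> space (W \<Otimes>\<^sub>M W) \<Longrightarrow> U (glue p) = U (fst p)"
        and small: "prob {\<omega>\<in>space W. \<epsilon> \<le> \<bar>U \<omega> - a \<omega>\<bar>} < \<delta> / 2"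
        using approx[OF \<epsilon>(1) half] by blast
      let ?G = "{p\<in>space (W \<Otimes>\<^sub>M W). \<epsilon> \<le> \<bar>U (glue p) - a (glue p)\<bar>}"
      let ?F = "{p\<in>space (W \<Otimes>\<^sub>M W). \<epsilon> \<le> \<bar>U (fst p) - a (fst p)\<bar>}"
      have "?B \<subseteq> ?G \<union> ?F"
      proof
        fix p assume p: "p \<in> ?B"
        then show "p \<in> ?G \<union> ?F" using glue[of p] \<epsilon>(2) by (auto simp: abs_if split: if_splits)
      qed
      then have "WW.prob ?B \<le> WW.prob (?G \<union> ?F)"
        by (intro WW.finite_measure_mono) auto
      also have "\<dots> \<le> WW.prob ?G + WW.prob ?F"
        by (intro measure_Un_le) measurable
      also have "\<dots> < \<delta>"
        using small prob_glue[of "\<lambda>\<omega>. \<epsilon> \<le> \<bar>U \<omega> - a \<omega>\<bar>"] prob_fst[of "\<lambda>\<omega>. \<epsilon> \<le> \<bar>U \<omega> - a \<omega>\<bar>"] by simp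
      finally show ?thesis by simp
    qed
    then have "WW.prob ?B \<le> 0" by (rule field_le_epsilon)
    then have "WW.prob ?B = 0" by (rule antisym[OF _ measure_nonneg])
    then have "AE p in W \<Otimes>\<^sub>M W. p \<notin> ?B" using WW.prob_eq_0[OF B] by simp
    then show ?thesis using AE_space by eventually_elim auto
  qed
  then have "AE p in W \<Otimes>\<^sub>M W. \<forall>m. \<not> 1 / real (Suc m) \<le> \<bar>a (glue p) - a (fst p)\<bar>"
    by (simp add: AE_all_countable)
  then show ?thesis
  proof eventually_elim
    case (elim p)
    show ?case
    proof (rule ccontr)
      assume "a (glue p) \<noteq> a (fst p)"
      then obtain m where "inverse (real (Suc m)) < \<bar>a (glue p) - a (fst p)\<bar>"
        using reals_Archimedean[of "\<bar>a (glue p) - a (fst p)\<bar>"] by auto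
      then show False using elim[rule_format, of m] by (simp add: inverse_eq_divide)
    qed
  qed
qed

text \<open>The cocycle shifts the path by \<open>- \<tau>\<close>, which preserves
  \<open>W\<close>.\<close>

lemma transition_eq_cocycle:
  assumes "0 \<le> t" "B \<in> sets borel"
  shows "transition W X t \<tau> x B = prob {\<omega>\<in>space W. \<Phi> t \<tau> \<omega> x \<in> B}"
proof -
  have [measurable]: "(\<lambda>\<omega>. X (\<tau> + t) \<tau> \<omega> x) \<in> borel_measurable W"
  proof -
    have "(\<lambda>\<omega>. (\<omega>, x)) \<in> W \<rightarrow>\<^sub>M W \<Otimes>\<^sub>M borel" by measurable
    from measurable_compose[OF this measurable_X[of \<tau> "\<tau> + t"]] show ?thesis using assms by simp
  qed
  have "{\<omega>\<in>space W. X (\<tau> + t) \<tau> \<omega> x \<in> B} \<in> sets W" using assms by measurable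
  from prob_wshift[OF this, of "- \<tau>"] show ?thesis
    by (simp add: transition_def cocycle_def add.commute)
qed

text \<open>Since \<open>glue\<close> maps the product of two Wiener measures to Wiener measure, a function determined by the past
  may be evaluated on a path independent of the one driving the cocycle.\<close>
lemma stationary_periodic_law:
  assumes a[measurable]: "\<And>\<tau>. a \<tau> \<in> borel_measurable W"
    and inv: "\<And>t \<tau>. 0 \<le> t \<Longrightarrow> AE \<omega> in W. \<Phi> t \<tau> \<omega> (a \<tau> \<omega>) = a (\<tau> + t) (wshift t \<omega>)"
    and past: "\<And>\<tau>. AE p in W \<Otimes>\<^sub>M W. a \<tau> (glue p) = a \<tau> (fst p)"
    and per: "\<And>\<tau>. AE \<omega> in W. a (\<tau> + T) \<omega> = a \<tau> \<omega>"
  shows "stationary_periodic_measure W X T (\<lambda>\<tau>. distr W borel (a \<tau>))"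
  unfolding stationary_periodic_measure_def
proof (intro conjI allI impI)
  interpret WW: pair_prob_space W W ..
  show "prob_space (distr W borel (a \<tau>))" for \<tau> by (rule prob_space_distr) simp
  show "distr W borel (a (\<tau> + T)) = distr W borel (a \<tau>)" for \<tau>
    using per by (intro distr_cong_AE) auto
  fix \<tau> t :: real and B :: "real set" assume t: "0 \<le> t" and B[measurable]: "B \<in> sets borel"
  note [measurable] = measurable_cocycle_compose[OF t]
  let ?S = "{p\<in>space (W \<Otimes>\<^sub>M W). \<Phi> t \<tau> (snd p) (a \<tau> (fst p)) \<in> B}"
  have S: "?S \<in> sets (W \<Otimes>\<^sub>M W)" by measurable
  have "measure (distr W borel (a (\<tau> + t))) B = prob {\<omega>\<in>space W. a (\<tau> + t) \<omega> \<in> B}"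
    by (subst measure_distr) (auto intro!: arg_cong[of _ _ prob])
  also have "\<dots> = prob {\<omega>\<in>space W. a (\<tau> + t) (wshift t \<omega>) \<in> B}"
    by (rule prob_wshift[symmetric]) measurable
  also have "\<dots> = prob {\<omega>\<in>space W. \<Phi> t \<tau> \<omega> (a \<tau> \<omega>) \<in> B}"
  proof (rule finite_measure_eq_AE)
    show "AE \<omega> in W. (\<omega> \<in> {\<omega>\<in>space W. a (\<tau> + t) (wshift t \<omega>) \<in> B})
        = (\<omega> \<in> {\<omega>\<in>space W. \<Phi> t \<tau> \<omega> (a \<tau> \<omega>) \<in> B})"
      using inv[OF t, of \<tau>] by eventually_elim auto
  qed measurable
  also have "\<dots> = WW.prob {p\<in>space (W \<Otimes>\<^sub>M W). \<Phi> t \<tau> (glue p) (a \<tau> (glue p)) \<in> B}"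
    by (rule prob_glue[symmetric]) measurable
  \<comment> \<open>The cocycle sees only \<open>snd p\<close>, its starting point almost surely
    only \<open>fst p\<close>: the two are now independent.\<close>
  also have "\<dots> = WW.prob ?S"
  proof (rule WW.finite_measure_eq_AE)
    show "AE p in W \<Otimes>\<^sub>M W. (p \<in> {p\<in>space (W \<Otimes>\<^sub>M W). \<Phi> t \<tau> (glue p) (a \<tau> (glue p)) \<in> B}) = (p \<in> ?S)"
      using past[of \<tau>] AE_space
      by eventually_elim (auto simp: cocycle_glue_future t space_pair_measure space_W)
  qed measurable
  finally have eq: "measure (distr W borel (a (\<tau> + t))) B = WW.prob ?S" .
  have tr_meas: "(\<lambda>x. transition W X t \<tau> x B) \<in> borel_measurable borel"
  proof -
    have "{p\<in>space (borel \<Otimes>\<^sub>M W). \<Phi> t \<tau> (snd p) (fst p) \<in> B} \<in> sets (borel \<Otimes>\<^sub>M W)" by measurable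
    from measurable_emeasure_Pair[OF this]
    have "(\<lambda>x. emeasure W {\<omega>\<in>space W. \<Phi> t \<tau> \<omega> x \<in> B}) \<in> borel_measurable borel"
      by (simp add: vimage_def space_pair_measure)
    then have "(\<lambda>x. enn2real (emeasure W {\<omega>\<in>space W. \<Phi> t \<tau> \<omega> x \<in> B})) \<in> borel_measurable borel" by measurable
    then show ?thesis by (simp add: transition_eq_cocycle[OF t B] measure_def)
  qed
  have tr_a: "(\<lambda>\<omega>. transition W X t \<tau> (a \<tau> \<omega>) B) \<in> borel_measurable W"
    using measurable_compose[OF a tr_meas] .
  \<comment> \<open>Fubini: for a fixed first path the section has the measure of a transition from
    \<open>a \<tau> \<omega>\<close>.\<close>
  have "ennreal (WW.prob ?S) = emeasure (W \<Otimes>\<^sub>M W) ?S" by (simp add: WW.emeasure_eq_measure)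
  also have "\<dots> = (\<integral>\<^sup>+\<omega>. emeasure W (Pair \<omega> -` ?S) \<partial>W)" by (rule emeasure_pair_measure_alt[OF S])
  also have "\<dots> = (\<integral>\<^sup>+\<omega>. ennreal (transition W X t \<tau> (a \<tau> \<omega>) B) \<partial>W)"
  proof (rule nn_integral_cong)
    fix \<omega> assume "\<omega> \<in> space W"
    then have "Pair \<omega> -` ?S = {\<omega>'\<in>space W. \<Phi> t \<tau> \<omega>' (a \<tau> \<omega>) \<in> B}"
      by (auto simp: space_pair_measure)
    then show "emeasure W (Pair \<omega> -` ?S) = ennreal (transition W X t \<tau> (a \<tau> \<omega>) B)"
      by (simp add: transition_eq_cocycle[OF t B] emeasure_eq_measure)
  qed
  also have "\<dots> = ennreal (\<integral>\<omega>. transition W X t \<tau> (a \<tau> \<omega>) B \<partial>W)"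
    using tr_a by (intro nn_integral_eq_integral integrable_const_bound[of _ 1]) (auto simp: transition_def)
  finally have "WW.prob ?S = (\<integral>\<omega>. transition W X t \<tau> (a \<tau> \<omega>) B \<partial>W)"
    by (subst (asm) ennreal_inj) (auto intro!: integral_nonneg simp: transition_def)
  also have "\<dots> = (\<integral>x. transition W X t \<tau> x B \<partial>distr W borel (a \<tau>))"
    using tr_meas by (intro integral_distr[symmetric]) auto
  finally show "measure (distr W borel (a (\<tau> + t))) B = (\<integral>x. transition W X t \<tau> x B \<partial>distr W borel (a \<tau>))"
    using eq by simp
qed simp

section \<open>The extremal points as random variables determined by the past\<close>

text \<open>Superlevel sets are projections, hence obtained as events of the completion; a Borel
  version is taken because \<open>glue\<close> and the product are formed with \<open>W\<close>
  itself.\<close>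

lemma extremum_measurable_version:
  assumes A: "nonaut_random_set W A" "\<And>\<omega>. \<omega> \<in> space W \<Longrightarrow> compact (A \<tau> \<omega>) \<and> A \<tau> \<omega> \<noteq> {}"
    and c: "c \<in> {1, -1}"
  shows "\<exists>g\<in>borel_measurable W. AE \<omega> in W. extremum c (A \<tau> \<omega>) = g \<omega>"
proof (rule completion_ex_borel_measurable_real)
  let ?S = "{(\<tau>, \<omega>, x). \<omega> \<in> space W \<and> x \<in> A \<tau> \<omega>}"
  have "Pair \<tau> -` ?S \<in> sets (W \<Otimes>\<^sub>M borel)"
    using A(1) unfolding nonaut_random_set_def by (rule sets_Pair1)
  moreover have "{p\<in>space (W \<Otimes>\<^sub>M (borel :: real measure)). q < c * snd p} \<in> sets (W \<Otimes>\<^sub>M borel)" for q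
    by measurable
  ultimately have M: "Pair \<tau> -` ?S \<inter> {p\<in>space (W \<Otimes>\<^sub>M (borel :: real measure)). q < c * snd p} \<in> sets (W \<Otimes>\<^sub>M borel)" for q
    by (rule sets.Int)
  have "(\<lambda>\<omega>. c * extremum c (A \<tau> \<omega>)) \<in> borel_measurable (completion W)"
    unfolding borel_measurable_iff_greater
  proof (intro allI)
    fix q
    have "{\<omega>\<in>space W. q < c * extremum c (A \<tau> \<omega>)} = {\<omega>\<in>space W. \<exists>x. (\<omega>, x) \<in>
        Pair \<tau> -` ?S \<inter> {p\<in>space (W \<Otimes>\<^sub>M (borel :: real measure)). q < c * snd p}}"
      using extremum_gt_iff[OF _ _ c] A(2) by (auto simp: space_pair_measure)
    also have "\<dots> \<in> sets (completion W)"
      by (rule measurable_projection[OF finite_measure_axioms M])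
    finally show "{\<omega>\<in>space (completion W). q < c * extremum c (A \<tau> \<omega>)} \<in> sets (completion W)"
      by simp
  qed
  then have "(\<lambda>\<omega>. c * (c * extremum c (A \<tau> \<omega>))) \<in> borel_measurable (completion W)"
    by (rule borel_measurable_times[OF borel_measurable_const])
  moreover have "c * (c * y) = y" for y :: real using c by auto
  ultimately show "(\<lambda>\<omega>. extremum c (A \<tau> \<omega>)) \<in> borel_measurable (completion W)"
    by (simp only:)
qed

text \<open>By monotonicity no image point passes the image of the extremal point.\<close>

lemma extremum_cocycle:
  assumes "\<omega> \<in> Omega0" "0 \<le> t" "c \<in> {1, -1}" "compact K" "K \<noteq> {}" "compact K'" "\<Phi> t \<tau> \<omega> ` K = K'"
  shows "extremum c K' = \<Phi> t \<tau> \<omega> (extremum c K)"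
  using assms extremum[of K c] by (intro extremum_eqI) (auto intro!: cocycle_mono_sign)

lemma AE_periodic_iterate:
  assumes per: "\<And>\<tau>. AE \<omega> in W. A (\<tau> + T) \<omega> = A \<tau> \<omega>"
  shows "AE \<omega> in W. A (\<tau> - real k * T) \<omega> = A \<tau> \<omega>"
proof (induction k)
  case (Suc k)
  then show ?case
    using per[of "\<tau> - real (Suc k) * T"] by eventually_elim (simp add: algebra_simps)
qed simp

text \<open>The approximation is the pullback solution from \<open>c * real n\<close> over
  \<open>k\<close> periods. Up to the sign \<open>c\<close>, attraction keeps it asymptotically
  below the extremum plus any tolerance, while invariance and order put it above the extremum
  whenever the extremum at the starting time is at most \<open>n\<close>. Over whole periods that
  starting value is \<open>g\<close> along the shifted path, with a law independent of
  \<open>k\<close>.\<close>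

lemma extremum_past_determined:
  assumes T: "T > 0" and att: "global_attractor W \<Phi> A" and per: "\<And>\<tau>. AE \<omega> in W. A (\<tau> + T) \<omega> = A \<tau> \<omega>"
    and c: "c \<in> {1, -1}" and g: "g \<in> borel_measurable W" "AE \<omega> in W. extremum c (A \<tau> \<omega>) = g \<omega>"
  shows "AE p in W \<Otimes>\<^sub>M W. g (glue p) = g (fst p)"
proof (rule AE_glue_eq_fst[OF g(1)])
  fix \<epsilon> \<delta> :: real assume pos: "\<epsilon> > 0" "\<delta> > 0"
  define \<phi> where "\<phi> k = (\<lambda>\<omega>. \<Phi> (real k * T) (\<tau> - real k * T) (wshift (- (real k * T)) \<omega>))" for k
  have kT: "0 \<le> real k * T" for k using T by simp
  have cpt: "compact (A \<tau> \<omega>)" "A \<tau> \<omega> \<noteq> {}" if "\<omega> \<in> Omega0" for \<omega> \<tau>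
    using att that unfolding global_attractor_def space_W by auto
  have cc: "c * (c * y) = y" "\<bar>c * y\<bar> = \<bar>y\<bar>" for y using c by auto
  have \<phi>_meas: "(\<lambda>\<omega>. \<phi> k \<omega> x) \<in> borel_measurable W" for k x
    unfolding \<phi>_def by (intro measurable_cocycle_compose[OF kT] measurable_wshift) auto
  have "\<exists>n k. prob {\<omega>\<in>space W. \<epsilon> \<le> \<bar>c * \<phi> k \<omega> (c * real n) - c * g \<omega>\<bar>} < \<delta>"
  proof (rule approx_in_probability[where \<theta> = "\<lambda>k. wshift (- (real k * T))", OF _ _ _ _ _ _ pos])
    fix n :: nat and \<eta> :: real assume "\<eta> > 0"
    have "AE \<omega> in W. ((\<lambda>t. hsemidist (\<Phi> t (\<tau> - t) (wshift (- t) \<omega>) ` {c * real n}) (A \<tau> \<omega>)) \<longlongrightarrow> 0) at_top"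
      using att unfolding global_attractor_def by (blast intro: bounded_insert[THEN iffD2] bounded_empty)
    then show "AE \<omega> in W. \<forall>\<^sub>F k in sequentially. c * \<phi> k \<omega> (c * real n) < c * g \<omega> + \<eta>"
      using g(2) AE_space
    proof eventually_elim
      case (elim \<omega>)
      have K: "compact (A \<tau> \<omega>)" "A \<tau> \<omega> \<noteq> {}"
        using cpt elim(3) by (simp_all add: space_W)
      have g_eq: "extremum c (A \<tau> \<omega>) = g \<omega>" by (fact elim(2))
      have "filterlim (\<lambda>k. real k * T) at_top sequentially"
        using T by (intro filterlim_at_top_mult_tendsto_pos[OF tendsto_const _ filterlim_real_sequentially])
      from filterlim_compose[OF elim(1) this]
      have "(\<lambda>k. infdist (\<phi> k \<omega> (c * real n)) (A \<tau> \<omega>)) \<longlonglongrightarrow> 0"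
        by (simp add: hsemidist_def \<phi>_def)
      then have "\<forall>\<^sub>F k in sequentially. infdist (\<phi> k \<omega> (c * real n)) (A \<tau> \<omega>) < \<eta>"
        using \<open>\<eta> > 0\<close> by (rule order_tendstoD(2))
      then show ?case
      proof eventually_elim
        case (elim k)
        obtain y where "y \<in> A \<tau> \<omega>" "infdist (\<phi> k \<omega> (c * real n)) (A \<tau> \<omega>) = dist (\<phi> k \<omega> (c * real n)) y"
          using infdist_attains_inf[OF compact_imp_closed[OF K(1)] K(2)] by blast
        with elim have y: "y \<in> A \<tau> \<omega>" "dist (\<phi> k \<omega> (c * real n)) y < \<eta>" by simp_all
        have "c * y \<le> c * g \<omega>"
          using extremum(2)[OF K c y(1)] unfolding g_eq .
        moreover have "c * \<phi> k \<omega> (c * real n) - c * y \<le> \<bar>\<phi> k \<omega> (c * real n) - y\<bar>"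
          using c by auto
        ultimately show ?case using y(2) by (simp add: dist_real_def)
      qed
    qed
  next
    fix n k
    let ?\<theta> = "wshift (- (real k * T))"
    have "AE \<omega> in W. \<Phi> (real k * T) (\<tau> - real k * T) \<omega> ` A (\<tau> - real k * T) \<omega>
        = A (\<tau> - real k * T + real k * T) (wshift (real k * T) \<omega>)"
      using att kT[of k] unfolding global_attractor_def invariant_set_def by blast
    then have "AE \<omega> in W. \<Phi> (real k * T) (\<tau> - real k * T) \<omega> ` A (\<tau> - real k * T) \<omega>
        = A \<tau> (wshift (real k * T) \<omega>)" unfolding diff_add_cancel .
    from AE_wshift[OF this, of "- (real k * T)"] AE_wshift[OF AE_periodic_iterate[of A T \<tau> k, OF per], of "- (real k * T)"]
      AE_wshift[OF g(2), of "- (real k * T)"] g(2) AE_space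
    show "AE \<omega> in W. c * g (?\<theta> \<omega>) \<le> real n \<longrightarrow> c * g \<omega> \<le> c * \<phi> k \<omega> (c * real n)"
    proof eventually_elim
      case (elim \<omega>)
      have \<omega>: "\<omega> \<in> Omega0" "?\<theta> \<omega> \<in> Omega0" using elim by (auto simp: space_W wshift_Omega0)
      \<comment> \<open>Invariance over \<open>k\<close> periods, with periodicity replacing the
        fibre at the starting time by the one at \<open>\<tau>\<close>.\<close>
      have "\<Phi> (real k * T) (\<tau> - real k * T) (?\<theta> \<omega>) ` A \<tau> (?\<theta> \<omega>) = A \<tau> \<omega>"
        using elim(1,2) \<omega> by (simp add: wshift_wshift wshift_0)
      then have "g \<omega> = \<phi> k \<omega> (g (?\<theta> \<omega>))"
        using extremum_cocycle[OF \<omega>(2) kT c cpt[OF \<omega>(2)] cpt(1)[OF \<omega>(1)]] elim(3,4) by (simp add: \<phi>_def)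
      then show ?case
        using cocycle_mono_sign[OF \<omega>(2) kT c, of "g (?\<theta> \<omega>)" "c * real n"] by (simp add: \<phi>_def cc)
    qed
  qed (use g(1) \<phi>_meas distr_wshift in auto)
  then obtain n k where nk: "prob {\<omega>\<in>space W. \<epsilon> \<le> \<bar>c * \<phi> k \<omega> (c * real n) - c * g \<omega>\<bar>} < \<delta>" by blast
  show "\<exists>U\<in>borel_measurable W. (\<forall>p\<in>space (W \<Otimes>\<^sub>M W). U (glue p) = U (fst p)) \<and>
      prob {\<omega>\<in>space W. \<epsilon> \<le> \<bar>U \<omega> - g \<omega>\<bar>} < \<delta>"
  proof (intro bexI[of _ "\<lambda>\<omega>. \<phi> k \<omega> (c * real n)"] conjI ballI)
    show "\<phi> k (glue p) (c * real n) = \<phi> k (fst p) (c * real n)" if "p \<in> space (W \<Otimes>\<^sub>M W)" for p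
      using that unfolding \<phi>_def by (intro cocycle_glue_past kT) (auto simp: space_pair_measure space_W)
    show "prob {\<omega>\<in>space W. \<epsilon> \<le> \<bar>\<phi> k \<omega> (c * real n) - g \<omega>\<bar>} < \<delta>"
      using nk by (simp add: right_diff_distrib[symmetric] cc)
  qed (rule \<phi>_meas)
qed

lemma extremum_stationary:
  assumes T: "T > 0" and att: "global_attractor W \<Phi> A" and per: "\<And>\<tau>. AE \<omega> in W. A (\<tau> + T) \<omega> = A \<tau> \<omega>"
    and c: "c \<in> {1, -1}" and g: "\<And>\<tau>. g \<tau> \<in> borel_measurable W" "\<And>\<tau>. AE \<omega> in W. extremum c (A \<tau> \<omega>) = g \<tau> \<omega>"
  shows "stationary_periodic_measure W X T (\<lambda>\<tau>. distr W borel (g \<tau>))"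
proof (rule stationary_periodic_law[OF g(1)])
  fix \<tau> show "AE p in W \<Otimes>\<^sub>M W. g \<tau> (glue p) = g \<tau> (fst p)"
    by (rule extremum_past_determined[OF T att per c g])
  show "AE \<omega> in W. g (\<tau> + T) \<omega> = g \<tau> \<omega>"
    using per[of \<tau>] g(2)[of \<tau>] g(2)[of "\<tau> + T"] by eventually_elim simp
next
  fix t \<tau> :: real assume t: "0 \<le> t"
  have "AE \<omega> in W. \<Phi> t \<tau> \<omega> ` A \<tau> \<omega> = A (\<tau> + t) (wshift t \<omega>)"
    using att t unfolding global_attractor_def invariant_set_def by blast
  then show "AE \<omega> in W. \<Phi> t \<tau> \<omega> (g \<tau> \<omega>) = g (\<tau> + t) (wshift t \<omega>)"
    using g(2)[of \<tau>] AE_wshift[OF g(2)[of "\<tau> + t"], of t] AE_space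
  proof eventually_elim
    case (elim \<omega>)
    have "compact (A \<tau> \<omega>)" "A \<tau> \<omega> \<noteq> {}" "compact (A (\<tau> + t) (wshift t \<omega>))"
      using att elim(4) unfolding global_attractor_def space_W by (auto simp: wshift_Omega0)
    with elim show ?case
      using extremum_cocycle[OF _ t c, of \<omega> "A \<tau> \<omega>" "A (\<tau> + t) (wshift t \<omega>)" \<tau>] by (simp add: space_W)
  qed
qed

end

theorem mainTheorem5:
  fixes f :: "real \<Rightarrow> real \<Rightarrow> real"
    and \<sigma> T :: real
    and W :: "(real \<Rightarrow> real) measure"
    and X :: "real \<Rightarrow> real \<Rightarrow> (real \<Rightarrow> real) \<Rightarrow> real \<Rightarrow> real"
    and A :: "real \<Rightarrow> (real \<Rightarrow> real) \<Rightarrow> real set"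
  assumes sigma_pos: "\<sigma> > 0"
    and T_pos: "T > 0"
    and f_C1: "C1_2 f"
    and f_periodic: "\<forall>t x. f (t + T) x = f t x"
    and wiener: "wiener_measure W"
    and solution: "pathwise_solution f \<sigma> X"
    and unique_measure: "\<exists>!\<rho>. stationary_periodic_measure W X T \<rho>"
    and attractor: "global_attractor W (cocycle X) A"
    and A_periodic: "\<forall>\<tau>. AE \<omega> in W. A (\<tau> + T) \<omega> = A \<tau> \<omega>"
  shows "random_periodic_orbit W (cocycle X) T A"
proof -
  interpret prob_space W using wiener by (simp add: wiener_measure_def)
  interpret additive_noise_sde W f \<sigma> X
    by unfold_locales (fact wiener f_C1 solution)+
  have per: "\<And>\<tau>. AE \<omega> in W. A (\<tau> + T) \<omega> = A \<tau> \<omega>" using A_periodic by blast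
  have inv: "invariant_set W (cocycle X) A"
    and cpt: "\<And>\<tau> \<omega>. \<omega> \<in> space W \<Longrightarrow> compact (A \<tau> \<omega>) \<and> A \<tau> \<omega> \<noteq> {}"
    using attractor unfolding global_attractor_def by blast+
  have meas: "nonaut_random_set W A" using inv by (simp add: invariant_set_def)
  \<comment> \<open>Versions are chosen for each \<open>\<tau>\<close> separately: all statements
    are almost sure at fixed times, so exceptional sets may vary with \<open>\<tau>\<close>.\<close>
  have version: "\<exists>g. \<forall>\<tau>. g \<tau> \<in> borel_measurable W \<and> (AE \<omega> in W. extremum c (A \<tau> \<omega>) = g \<tau> \<omega>)"
    if "c \<in> {1, -1}" for c
    using extremum_measurable_version[OF meas cpt that] by (intro choice) blast
  obtain u where u: "\<And>\<tau>. u \<tau> \<in> borel_measurable W" "\<And>\<tau>. AE \<omega> in W. extremum 1 (A \<tau> \<omega>) = u \<tau> \<omega>"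
    using version[of 1] by blast
  obtain l where l: "\<And>\<tau>. l \<tau> \<in> borel_measurable W" "\<And>\<tau>. AE \<omega> in W. extremum (-1) (A \<tau> \<omega>) = l \<tau> \<omega>"
    using version[of "-1"] by blast
  have "stationary_periodic_measure W X T (\<lambda>\<tau>. distr W borel (u \<tau>))"
    by (rule extremum_stationary[OF T_pos attractor per _ u]) simp
  moreover have "stationary_periodic_measure W X T (\<lambda>\<tau>. distr W borel (l \<tau>))"
    by (rule extremum_stationary[OF T_pos attractor per _ l]) simp
  ultimately have "(\<lambda>\<tau>. distr W borel (l \<tau>)) = (\<lambda>\<tau>. distr W borel (u \<tau>))"
    using unique_measure by blast
  then have law: "distr W borel (l \<tau>) = distr W borel (u \<tau>)" for \<tau> by meson
  have "AE \<omega> in W. \<exists>a. A \<tau> \<omega> = {a}" for \<tau>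
  proof -
    have bounds: "AE \<omega> in W. A \<tau> \<omega> \<noteq> {} \<and> A \<tau> \<omega> \<subseteq> {l \<tau> \<omega>..u \<tau> \<omega>}"
      using u(2)[of \<tau>] l(2)[of \<tau>] AE_space
    proof eventually_elim
      case (elim \<omega>)
      then show ?case
        using cpt[of \<omega> \<tau>] extremum(2)[of "A \<tau> \<omega>" 1] extremum(2)[of "A \<tau> \<omega>" "-1"] by auto
    qed
    then have "AE \<omega> in W. l \<tau> \<omega> \<le> u \<tau> \<omega>" by eventually_elim auto
    then have "AE \<omega> in W. l \<tau> \<omega> = u \<tau> \<omega>" by (rule AE_eq_if_distr_eq[OF l(1) u(1) _ law])
    with bounds show ?thesis by eventually_elim (auto simp: subset_singleton_iff)
  qed
  \<comment> \<open>Invariance over one period, combined with periodicity of \<open>A\<close>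
    transported along the measure-preserving shift.\<close>
  moreover have "AE \<omega> in W. cocycle X T \<tau> \<omega> ` A \<tau> \<omega> = A \<tau> (wshift T \<omega>)" for \<tau>
  proof -
    have "AE \<omega> in W. cocycle X T \<tau> \<omega> ` A \<tau> \<omega> = A (\<tau> + T) (wshift T \<omega>)"
      using inv T_pos by (simp add: invariant_set_def)
    then show ?thesis
      using AE_wshift[OF per[of \<tau>], of T] by eventually_elim simp
  qed
  ultimately show ?thesis using inv by (simp add: random_periodic_orbit_def)
qed

end
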